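(* Let $K$ be a field, let $V$ be an $n$-dimensional $K$-vector space, and let $V_1,\dots,V_m\subseteq V$ be linear subspaces with codimensions $c_i=n-\dim V_i$. Assume that the arrangement $V_1,\dots,V_m$ is transversal, and let $I=I_1\cap I_2\cap\cdots\cap I_m\subseteq K[V]$, where $I_j$ is the ideal of $V_j$. Suppose that $c_1,\dots,c_m$ are unknown, but that the values $h_I(d)$ are known for $d=m,m+1,\dots,m+n-1$ (for these $d$ the Hilbert function and the Hilbert polynomial of $I$ agree). Then $c_1,\dots,c_m$ can be recovered, that is, these values (with $n$ and $m$ given) determine $c_1,\dots,c_m$ up to order.
   Context: $K[V]\cong K[x_1,\dots,x_n]$ is the polynomial coordinate ring of $V$ with its standard grading. $I_j\subseteq K[V]$ is the vanishing ideal of $V_j$, understood as the linear ideal generated by the linear forms vanishing on $V_j$. For a homogeneous ideal $I$, $h_I(d)=\dim_K I_d$ is its Hilbert function; its Hilbert polynomial is the polynomial in $d$ that equals $h_I(d)$ for all large $d$. The subspaces $V_1,\dots,V_m$ are called transversal if for all $S\subseteq\{1,\dots,m\}$ the codimension $c_S$ of $\bigcap_{i\in S}V_i$ in $V$ (the empty intersection being $V$) satisfies $c_S=\min\big(n,\sum_{i\in S}c_i\big)$.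
   Formalization: The recovery claim assumes, when n > 0, that the subspaces V_i of one of the two compared arrangements are proper (c_i > 0); otherwise it is false: for n=3, m=2, c=(0,1) and c=(0,2) both give I=0 and the same values h_I(d)=0. *)

theory Defs
  imports
    "HOL-Library.Poly_Mapping"
    "HOL-Library.Multiset"
    "HOL-Computational_Algebra.Polynomial"
begin

definition codim :: "('k::field \<Rightarrow> 'v::ab_group_add \<Rightarrow> 'v) \<Rightarrow> 'v set \<Rightarrow> nat" where
  "codim scale U = vector_space.dim scale UNIV - vector_space.dim scale U"

definition transversal ::
    "('k::field \<Rightarrow> 'v::ab_group_add \<Rightarrow> 'v) \<Rightarrow> nat \<Rightarrow> (nat \<Rightarrow> 'v set) \<Rightarrow> bool" where
  "transversal scale m V \<longleftrightarrow>
     (\<forall>S\<subseteq>{..<m}. codim scale (\<Inter>i\<in>S. V i) =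
        min (vector_space.dim scale UNIV) (\<Sum>i\<in>S. codim scale (V i)))"

text \<open>
  A basis \<open>B\<close> of \<open>V\<close> identifies the coordinate ring of \<open>V\<close> with the polynomial ring having one
  variable for each element of \<open>B\<close>, namely the corresponding coordinate function. A polynomial is
  a finitely supported map from monomials to coefficients, and a monomial a finitely supported
  map from variables to exponents. Every vector may index a variable in the type below;
  \<open>coord_ring B\<close> consists of the polynomials in which only variables from \<open>B\<close> occur.
\<close>

type_synonym ('v, 'k) mpoly = "('v \<Rightarrow>\<^sub>0 nat) \<Rightarrow>\<^sub>0 'k"

definition coord_ring :: "'v set \<Rightarrow> ('v, 'k::field) mpoly set" where
  "coord_ring B = {p. \<forall>t \<in> Poly_Mapping.keys p. Poly_Mapping.keys t \<subseteq> B}"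

text \<open>A linear functional \<open>f\<close> is the combination of the coordinate functions with coefficients
  its values on the basis.\<close>

definition linear_form :: "'v set \<Rightarrow> ('v \<Rightarrow> 'k::field) \<Rightarrow> ('v, 'k) mpoly" where
  "linear_form B f = (\<Sum>b\<in>B. Poly_Mapping.single (Poly_Mapping.single b 1) (f b))"

text \<open>The ideal generated by \<open>S\<close> in a subring \<open>R\<close>, where \<open>S \<subseteq> R\<close>.\<close>

definition ideal_generated :: "'a::comm_ring_1 set \<Rightarrow> 'a set \<Rightarrow> 'a set" where
  "ideal_generated R S = {\<Sum>l\<in>A. a l * l | a A. finite A \<and> A \<subseteq> S \<and> (\<forall>l\<in>A. a l \<in> R)}"

definition subspace_ideal ::
    "('k::field \<Rightarrow> 'v::ab_group_add \<Rightarrow> 'v) \<Rightarrow> 'v set \<Rightarrow> 'v set \<Rightarrow> ('v, 'k) mpoly set" where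
  "subspace_ideal scale B U = ideal_generated (coord_ring B)
     {linear_form B f | f. Vector_Spaces.linear scale (*) f \<and> (\<forall>u\<in>U. f u = 0)}"

text \<open>Intersecting with \<open>coord_ring B\<close> only matters for \<open>m = 0\<close>, where it yields the unit ideal.\<close>

definition arrangement_ideal ::
    "('k::field \<Rightarrow> 'v::ab_group_add \<Rightarrow> 'v) \<Rightarrow> 'v set \<Rightarrow> nat \<Rightarrow> (nat \<Rightarrow> 'v set) \<Rightarrow> ('v, 'k) mpoly set" where
  "arrangement_ideal scale B m V = coord_ring B \<inter> (\<Inter>j<m. subspace_ideal scale B (V j))"

definition total_degree :: "('v \<Rightarrow>\<^sub>0 nat) \<Rightarrow> nat" where
  "total_degree t = (\<Sum>x\<in>Poly_Mapping.keys t. Poly_Mapping.lookup t x)"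

definition homogeneous_part :: "('v, 'k::field) mpoly set \<Rightarrow> nat \<Rightarrow> ('v, 'k) mpoly set" where
  "homogeneous_part I d = {p \<in> I. \<forall>t \<in> Poly_Mapping.keys p. total_degree t = d}"

definition scale_mpoly :: "'k::field \<Rightarrow> ('v, 'k) mpoly \<Rightarrow> ('v, 'k) mpoly" where
  "scale_mpoly c p = Poly_Mapping.single 0 c * p"

lemma vector_space_scale_mpoly: "vector_space scale_mpoly"
  by unfold_locales
    (simp_all add: scale_mpoly_def distrib_left distrib_right single_add mult_single
      mult.assoc [symmetric])

definition hilbert_function :: "('v, 'k::field) mpoly set \<Rightarrow> nat \<Rightarrow> nat" where
  "hilbert_function I d = vector_space.dim scale_mpoly (homogeneous_part I d)"

definition is_hilbert_polynomial :: "('v, 'k::field) mpoly set \<Rightarrow> rat poly \<Rightarrow> bool" where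
  "is_hilbert_polynomial I q \<longleftrightarrow>
     (\<forall>\<^sub>F d in sequentially. of_nat (hilbert_function I d) = poly q (of_nat d))"

end

theory Submission
  imports
    Defs
    "HOL-Library.Function_Algebras"
    "HOL-Computational_Algebra.Polynomial_Factorial"
begin

text \<open>
  Let \<open>R\<close> be the polynomial ring and \<open>I\<^sub>S\<close> the sum of the ideals \<open>I\<^sub>i\<close> with \<open>i \<in> S\<close>. This is again an
  ideal generated by linear forms, and transversality says that these forms span a space of dimension
  \<open>min n (\<Sum>i\<in>S. c\<^sub>i)\<close>. The heart of the proof is that for \<open>d \<ge> m\<close> the dimension of \<open>I\<close> in degree \<open>d\<close>
  is given by inclusion and exclusion, as the alternating sum over \<open>S\<close> of the dimensions of \<open>R / I\<^sub>S\<close> in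
  degree \<open>d\<close>. The quotient \<open>R / I\<^sub>S\<close> is a polynomial ring whose number of variables is \<open>n\<close> minus the
  dimension above, so the sum is the value at the polynomial \<open>\<Prod>i. 1 - u\<^bsup>c\<^sub>i\<^esup>\<close> of the linear
  functional that sends \<open>u\<^sup>k\<close> to the Hilbert function of a polynomial ring in \<open>n - k\<close> variables
  (\<open>hilbert_function_arrangement_ideal\<close>).

  Inclusion and exclusion can fail because sums and intersections of ideals do not distribute.
  What saves it is that in degrees \<open>d \<ge> m\<close> the intersection of the \<open>I\<^sub>i\<close> equals their product
  (\<open>intersection_subset_product\<close>). Products are compatible with passing to a quotient ring, so modulo
  \<open>I\<^sub>m\<close> the intersection of \<open>I\<^sub>1, \<dots>, I\<^bsub>m-1\<^esub>\<close> becomes the intersection of their images, which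
  belong to a transversal arrangement in \<open>V\<^sub>m\<close>; induction on \<open>m\<close> does the rest
  (\<open>span_intersection_ideal\<close>, \<open>dim_intersection_rel\<close>).

  Intersection and product agree by an induction that divides out one linear form \<open>x\<close> of \<open>I\<^sub>m\<close> at a
  time. Modulo \<open>x\<close> the statement is known, and the remainder is a multiple \<open>x * g\<close>. If \<open>x\<close> is generic
  then \<open>x\<close> is a nonzerodivisor modulo the other ideals, so \<open>g\<close> lies in \<open>I\<^sub>1, \<dots>, I\<^bsub>m-1\<^esub>\<close>, hence in
  their product, and \<open>x * g\<close> lies in the product of all the ideals.

  A generic form need not exist over a finite field. Therefore all dimensions are computed after
  extending the scalars from \<open>K\<close> to the rational function field \<open>K(t)\<close>, which changes no dimension
  and commutes with sums, products and intersections (locale \<open>scalar_extension\<close>). Over the infinite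
  field \<open>K(t)\<close> polynomials may be treated as functions, and that \<open>x\<close> is a nonzerodivisor modulo an
  ideal of linear forms becomes a statement about vanishing on a linear subspace.

  Finally the Hilbert functions of polynomial rings in \<open>1, \<dots>, n\<close> variables are polynomials in \<open>d\<close> of
  the distinct degrees \<open>0, \<dots>, n - 1\<close>. So \<open>n\<close> consecutive values determine \<open>\<Prod>i. 1 - u\<^bsup>c\<^sub>i\<^esup>\<close> modulo
  \<open>u\<^sup>n\<close> (\<open>hilbert_functional_determines_coeffs\<close>). The smallest exponent at which two such products
  differ shows up in their coefficients, which recovers the \<open>c\<^sub>i < n\<close> with multiplicities; the
  remaining ones are equal to \<open>n\<close>, and their number is known because \<open>m\<close> is (\<open>codim_product_inject\<close>).
\<close>

section \<open>Subspaces of finite dimension\<close>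

text \<open>
  The ambient spaces below, polynomial rings and function spaces, have infinite dimension, and only
  their homogeneous parts have finite dimension. Hence finite dimension is a property of subspaces here.
\<close>

locale subspaces = vector_space scale
  for scale :: "'a::field \<Rightarrow> 'b::ab_group_add \<Rightarrow> 'b"
begin

definition fin_dim :: "'b set \<Rightarrow> bool" where
  "fin_dim U \<longleftrightarrow> (\<exists>B. finite B \<and> U \<subseteq> span B)"

lemma fin_dim_subset: "U \<subseteq> W \<Longrightarrow> fin_dim W \<Longrightarrow> fin_dim U"
  unfolding fin_dim_def by blast

lemma fin_dim_span: "fin_dim U \<Longrightarrow> fin_dim (span U)"
  unfolding fin_dim_def by (metis span_mono span_span)

lemma fin_dim_Un: "fin_dim U \<Longrightarrow> fin_dim W \<Longrightarrow> fin_dim (U \<union> W)"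
  unfolding fin_dim_def
  by (metis Un_least Un_upper1 Un_upper2 finite_UnI order_trans span_mono)

lemma fin_dim_finite: "finite B \<Longrightarrow> fin_dim B"
  unfolding fin_dim_def using span_superset by blast

lemma fin_dim_independent_finite:
  assumes "fin_dim U" "B \<subseteq> U" "independent B"
  shows "finite B"
  using assms independent_span_bound unfolding fin_dim_def by (meson subset_trans)

lemma fin_dim_basis_extend:
  assumes "fin_dim W" "subspace W" "C \<subseteq> W" "independent C"
  obtains D where "C \<subseteq> D" "finite D" "independent D" "span D = W" "card D = dim W"
proof -
  obtain D where D: "C \<subseteq> D" "D \<subseteq> W" "independent D" "W \<subseteq> span D"
    using maximal_independent_subset_extend[OF assms(3,4)] by blast
  have "span D = W" using D assms(2) by (simp add: span_minimal subset_antisym)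
  moreover have "card D = dim W" using D basis_card_eq_dim by blast
  ultimately show ?thesis using that D fin_dim_independent_finite[OF assms(1) D(2,3)] by blast
qed

lemma fin_dim_basis:
  assumes "fin_dim W" "subspace W"
  obtains D where "finite D" "independent D" "span D = W" "card D = dim W"
  using fin_dim_basis_extend[OF assms, of "{}"] independent_empty by blast

lemma fin_dim_dim_mono:
  assumes "U \<subseteq> W" "fin_dim W"
  shows "dim U \<le> dim W"
proof -
  have "fin_dim (span W)" by (simp add: assms(2) fin_dim_span)
  then obtain D where D: "finite D" "span D = span W" "card D = dim (span W)"
    using fin_dim_basis[of "span W"] subspace_span by metis
  then have "dim U \<le> card D" using assms(1) dim_le_card span_superset by (metis order_trans)
  then show ?thesis using D by simp
qed

lemma fin_dim_dim_equal:
  assumes "U \<subseteq> W" "fin_dim W" "subspace U" "subspace W" "dim W \<le> dim U"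
  shows "U = W"
proof -
  obtain C where C: "finite C" "independent C" "span C = U" "card C = dim U"
    using fin_dim_basis fin_dim_subset assms by metis
  have "C \<subseteq> W" using C assms(1) span_superset by blast
  then obtain D where D: "C \<subseteq> D" "finite D" "span D = W" "card D = dim W"
    using fin_dim_basis_extend assms(2,4) C(2) by metis
  have "card D \<le> card C" using C(4) D(4) assms(5) by simp
  then have "C = D" using card_seteq[OF D(2,1)] by simp
  then show ?thesis using C(3) D(3) by simp
qed

lemma span_Un_subspaces:
  assumes "subspace U" "subspace W"
  shows "span (U \<union> W) = {x + y |x y. x \<in> U \<and> y \<in> W}"
  using assms by (simp add: span_Un span_eq_iff[THEN iffD2])

text \<open>
  A basis of \<open>U \<inter> W\<close> is extended to a basis \<open>D\<close> of \<open>U\<close> and to a basis \<open>E\<close> of \<open>W\<close>. The vectors of \<open>E\<close>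
  outside \<open>U \<inter> W\<close> can be added to \<open>D\<close> one by one: a relation would put a vector of \<open>W\<close> into \<open>U\<close>,
  that is into the span of the common basis.
\<close>

lemma dim_span_Un_Int:
  assumes U: "subspace U" "fin_dim U" and W: "subspace W" "fin_dim W"
  shows "dim (span (U \<union> W)) + dim (U \<inter> W) = dim U + dim W"
proof -
  have I: "subspace (U \<inter> W)" "fin_dim (U \<inter> W)"
    using assms by (auto intro: subspace_inter fin_dim_subset)
  obtain C where C: "finite C" "independent C" "span C = U \<inter> W" "card C = dim (U \<inter> W)"
    using fin_dim_basis I by metis
  have CU: "C \<subseteq> U" "C \<subseteq> W" using C span_superset by blast+
  obtain D where D: "C \<subseteq> D" "finite D" "independent D" "span D = U" "card D = dim U"
    using fin_dim_basis_extend[OF U(2,1) CU(1) C(2)] by metis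
  obtain E where E: "C \<subseteq> E" "finite E" "independent E" "span E = W" "card E = dim W"
    using fin_dim_basis_extend[OF W(2,1) CU(2) C(2)] by metis
  have ind: "independent (D \<union> F) \<and> D \<inter> F = {}" if "F \<subseteq> E - C" for F
  proof -
    have "finite F" using that E(2) finite_subset by blast
    then show ?thesis using that
    proof (induction F)
      case empty
      then show ?case using D by simp
    next
      case (insert x F)
      have "x \<notin> span (D \<union> F)"
      proof
        assume "x \<in> span (D \<union> F)"
        then obtain u w where uw: "x = u + w" "u \<in> span D" "w \<in> span F"
          unfolding span_Un by blast
        have "F \<subseteq> E" "x \<in> E" "x \<notin> C" "x \<notin> F" using insert by auto
        have "w \<in> W" using uw(3) \<open>F \<subseteq> E\<close> E(4) span_mono by blast
        moreover have "x \<in> W" using \<open>x \<in> E\<close> E(4) span_superset by blast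
        ultimately have "u \<in> W" using uw(1) W(1) subspace_diff
          by (metis add_diff_cancel_right')
        then have "u \<in> span C" using uw(2) D(4) C(3) by blast
        then have "x \<in> span (C \<union> F)" using uw unfolding span_Un by blast
        moreover have "C \<union> F \<subseteq> E - {x}" using E(1) \<open>F \<subseteq> E\<close> \<open>x \<notin> C\<close> \<open>x \<notin> F\<close> by blast
        ultimately have "x \<in> span (E - {x})" using span_mono by blast
        then show False using E(3) \<open>x \<in> E\<close> dependent_def by blast
      qed
      moreover from this have "x \<notin> D" using span_superset by blast
      ultimately show ?case using insert independent_insertI[of x "D \<union> F"] by auto
    qed
  qed
  have DE: "independent (D \<union> (E - C))" "D \<inter> (E - C) = {}" using ind[of "E - C"] by auto
  have "D \<union> (E - C) = D \<union> E" using D(1) by blast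
  then have "span (D \<union> (E - C)) = span (U \<union> W)"
    by (simp only: span_Un_subspaces[OF U(1) W(1)]) (simp only: span_Un D(4) E(4))
  then have "dim (span (U \<union> W)) = card (D \<union> (E - C))"
    using dim_span_eq_card_independent[OF DE(1)] by simp
  also have "\<dots> = card D + card (E - C)"
    using D(2) E(2) DE(2) by (simp add: card_Un_disjoint)
  also have "card (E - C) = card E - card C" using C(1) E(1) by (simp add: card_Diff_subset)
  finally show ?thesis using C(4) D(5) E(5) card_mono[OF E(2,1)] by simp
qed

lemma dim_span_insert:
  assumes "subspace U" "fin_dim U" "x \<notin> U"
  shows "dim (span (insert x U)) = Suc (dim U)"
proof -
  obtain D where D: "finite D" "independent D" "span D = U" "card D = dim U"
    using fin_dim_basis assms by metis
  have "independent (insert x D)" "x \<notin> D"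
    using assms(3) D independent_insertI span_superset by auto
  moreover have "span (insert x U) = span (insert x D)"
    using D(3) by (simp add: span_insert span_eq_iff[THEN iffD2, OF assms(1)])
  ultimately show ?thesis using D by (simp add: dim_eq_card_independent)
qed

text \<open>
  Over an infinite field a vector space is not a finite union of proper subspaces (over a finite field
  every plane is a finite union of lines). If \<open>x\<close> avoids all but one of the subspaces and \<open>y\<close> avoids the
  last one, two of the infinitely many vectors \<open>x + c y\<close> would have to lie in the same subspace, which
  then contains \<open>y\<close> and \<open>x\<close>.
\<close>

lemma avoid_finitely_many_subspaces:
  assumes inf: "infinite (UNIV :: 'a set)" and "finite \<W>" and U: "subspace U"
    and "\<And>W. W \<in> \<W> \<Longrightarrow> subspace W \<and> \<not> U \<subseteq> W"
  shows "\<exists>x\<in>U. \<forall>W\<in>\<W>. x \<notin> W"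
  using assms(2,4)
proof (induction \<W>)
  case empty
  then show ?case using U subspace_0 by blast
next
  case (insert W \<W>)
  obtain x where x: "x \<in> U" "\<forall>T\<in>\<W>. x \<notin> T" using insert by auto
  obtain y where y: "y \<in> U" "y \<notin> W" using insert by blast
  have W: "subspace W" using insert by blast
  show ?case
  proof (rule ccontr)
    assume neg: "\<not> ?thesis"
    have *: "\<exists>T\<in>insert W \<W>. x + scale c y \<in> T" for c
      using neg x(1) y(1) U by (meson subspace_add subspace_scale)
    then obtain t where t: "t c \<in> insert W \<W>" "x + scale c y \<in> t c" for c by metis
    have fin: "finite (insert W \<W>)" using insert by simp
    then obtain T where T: "T \<in> insert W \<W>" "infinite {c \<in> UNIV. t c = T}"
      using pigeonhole_infinite[OF inf, of t] finite_subset[of "t ` UNIV"] t(1)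
      by (metis (no_types, lifting) Collect_cong UNIV_I imageE image_subset_iff)
    have "subspace T" using T(1) insert by blast
    obtain a where a: "t a = T" using T(2) not_finite_existsD by blast
    have "infinite ({c \<in> UNIV. t c = T} - {a})" using T(2) by simp
    then obtain b where b: "t b = T" "b \<noteq> a" using infinite_imp_nonempty by blast
    have "(x + scale a y) - (x + scale b y) \<in> T"
      using t(2)[of a] t(2)[of b] a b \<open>subspace T\<close> subspace_diff by metis
    then have "scale (a - b) y \<in> T" by (simp add: scale_left_diff_distrib)
    then have "scale (inverse (a - b)) (scale (a - b) y) \<in> T"
      using \<open>subspace T\<close> subspace_scale by blast
    then have yT: "y \<in> T" using b(2) by simp
    then have "T \<noteq> W" using y by blast
    then have "T \<in> \<W>" using T(1) by blast
    have "(x + scale a y) - scale a y \<in> T"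
      using t(2)[of a] a yT \<open>subspace T\<close> by (metis subspace_diff subspace_scale)
    then show False using x(2) \<open>T \<in> \<W>\<close> by simp
  qed
qed

end

section \<open>Graded pieces of ideals generated by linear forms\<close>

locale commutative_algebra = subspaces scale
  for scale :: "'a::field \<Rightarrow> 'b::comm_ring_1 \<Rightarrow> 'b" +
  assumes scale_mult_left: "scale c x * y = scale c (x * y)"
begin

lemma scale_mult_right: "x * scale c y = scale c (x * y)"
  by (metis mult.commute scale_mult_left)

definition product :: "'b set \<Rightarrow> 'b set \<Rightarrow> 'b set" where
  "product X Y = span {x * y |x y. x \<in> X \<and> y \<in> Y}"

lemma subspace_product [simp]: "subspace (product X Y)"
  by (simp add: product_def)

lemma product_subset:
  "subspace Z \<Longrightarrow> (\<And>x y. x \<in> X \<Longrightarrow> y \<in> Y \<Longrightarrow> x * y \<in> Z) \<Longrightarrow> product X Y \<subseteq> Z"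
  unfolding product_def by (rule span_minimal) auto

lemma productI: "x \<in> X \<Longrightarrow> y \<in> Y \<Longrightarrow> x * y \<in> product X Y"
  unfolding product_def by (rule span_base) auto

lemma product_mono: "X \<subseteq> X' \<Longrightarrow> Y \<subseteq> Y' \<Longrightarrow> product X Y \<subseteq> product X' Y'"
  by (rule product_subset) (auto intro: productI)

lemma mult_mem_product_of_span:
  assumes "x \<in> span X" "y \<in> span Y"
  shows "x * y \<in> product X Y"
proof -
  have 1: "a * y \<in> product X Y" if "a \<in> X" for a
    using assms(2)
  proof (induction rule: span_induct)
    case base
    show ?case
      by (rule subspaceI) (simp_all add: distrib_left scale_mult_right subspace_0 subspace_add subspace_scale)
  next
    case (step b)
    then show ?case using that by (simp add: productI)
  qed
  show ?thesis
    using assms(1)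
  proof (induction rule: span_induct)
    case base
    show ?case
      by (rule subspaceI) (simp_all add: distrib_right scale_mult_left subspace_0 subspace_add subspace_scale)
  next
    case (step b)
    then show ?case using 1 by simp
  qed
qed

lemma fin_dim_product:
  assumes "fin_dim X" "fin_dim Y"
  shows "fin_dim (product X Y)"
proof -
  obtain A B where AB: "finite A" "X \<subseteq> span A" "finite B" "Y \<subseteq> span B"
    using assms unfolding fin_dim_def by blast
  have "product X Y \<subseteq> product A B"
    using AB by (intro product_subset) (auto intro: mult_mem_product_of_span)
  moreover have "finite {x * y |x y. x \<in> A \<and> y \<in> B}"
    using AB by (simp add: finite_image_set2)
  ultimately show ?thesis unfolding fin_dim_def product_def by blast
qed

end

text \<open>
  Only homogeneous elements matter, so the grading consists of the subspaces \<open>forms d\<close> spanned by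
  products of \<open>d\<close> elements of \<open>L\<close>. Likewise \<open>ideal_forms M d\<close> is the part of degree \<open>d\<close> of the ideal
  generated by \<open>M \<subseteq> L\<close>, and \<open>product_forms F m d\<close> that of the product of the \<open>m\<close> ideals generated by
  \<open>F 0, \<dots>, F (m - 1)\<close>; the latter is zero for \<open>d < m\<close>.
\<close>

locale graded_algebra = commutative_algebra scale
  for scale :: "'a::field \<Rightarrow> 'b::comm_ring_1 \<Rightarrow> 'b" +
  fixes L :: "'b set"
  assumes subspace_L: "subspace L" and fin_dim_L: "fin_dim L"
begin

primrec forms :: "nat \<Rightarrow> 'b set" where
  "forms 0 = span {1}"
| "forms (Suc d) = product L (forms d)"

primrec ideal_forms :: "'b set \<Rightarrow> nat \<Rightarrow> 'b set" where
  "ideal_forms M 0 = {0}"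
| "ideal_forms M (Suc d) = product M (forms d)"

primrec product_forms :: "(nat \<Rightarrow> 'b set) \<Rightarrow> nat \<Rightarrow> nat \<Rightarrow> 'b set" where
  "product_forms F 0 d = forms d"
| "product_forms F (Suc m) d =
     (case d of 0 \<Rightarrow> {0} | Suc d' \<Rightarrow> product (F m) (product_forms F m d'))"

lemma subspace_forms [simp]: "subspace (forms d)"
  by (cases d) auto

lemma subspace_ideal_forms [simp]: "subspace (ideal_forms M d)"
  by (cases d) (auto simp: subspace_single_0)

lemma subspace_product_forms [simp]: "subspace (product_forms F m d)"
  by (cases m; cases d) (auto simp: subspace_single_0)

lemma fin_dim_forms [simp]: "fin_dim (forms d)"
  by (induction d) (auto simp: fin_dim_product fin_dim_L fin_dim_span fin_dim_finite)

lemma ideal_forms_mono: "M \<subseteq> N \<Longrightarrow> ideal_forms M d \<subseteq> ideal_forms N d"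
  by (cases d) (auto dest: product_mono[OF _ order_refl])

lemma ideal_forms_L: "0 < d \<Longrightarrow> ideal_forms L d = forms d"
  by (cases d) auto

lemma ideal_forms_subset: "M \<subseteq> L \<Longrightarrow> ideal_forms M d \<subseteq> forms d"
  using ideal_forms_mono[of M L d] ideal_forms_L[of d]
  by (cases "d = 0") (auto simp: subspace_0 span_zero)

lemma fin_dim_ideal_forms: "M \<subseteq> L \<Longrightarrow> fin_dim (ideal_forms M d)"
  using fin_dim_subset[OF ideal_forms_subset] by simp

lemma mult_ideal_forms:
  assumes "M \<subseteq> L" "x \<in> L" "y \<in> ideal_forms M d"
  shows "x * y \<in> ideal_forms M (Suc d)"
proof (cases d)
  case 0
  then show ?thesis using assms subspace_0 by simp
next
  case (Suc d')
  have "product M (forms d') \<subseteq> {y. x * y \<in> ideal_forms M (Suc d)}"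
  proof (rule product_subset)
    show "subspace {y. x * y \<in> ideal_forms M (Suc d)}"
      by (rule subspaceI) (simp_all add: distrib_left scale_mult_right subspace_0 subspace_add
          subspace_scale del: ideal_forms.simps)
  next
    fix a b assume "a \<in> M" "b \<in> forms d'"
    then have "a * (x * b) \<in> ideal_forms M (Suc d)"
      using assms(2) Suc by (auto intro: productI)
    then show "a * b \<in> {y. x * y \<in> ideal_forms M (Suc d)}"
      by (simp add: mult.left_commute)
  qed
  then show ?thesis using assms(3) Suc by auto
qed

lemma ideal_forms_span_Un: "ideal_forms (span (M \<union> N)) d = span (ideal_forms M d \<union> ideal_forms N d)"
proof (cases d)
  case 0
  then show ?thesis by simp
next
  case (Suc d')
  have "product (span (M \<union> N)) (forms d') \<subseteq> span (ideal_forms M d \<union> ideal_forms N d)"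
  proof (rule product_subset)
    fix x y assume xy: "x \<in> span (M \<union> N)" "y \<in> forms d'"
    then have "x * y \<in> product (M \<union> N) (forms d')"
      using mult_mem_product_of_span span_base by blast
    moreover have "product (M \<union> N) (forms d') \<subseteq> span (ideal_forms M d \<union> ideal_forms N d)"
      using Suc by (intro product_subset) (auto intro!: span_base productI)
    ultimately show "x * y \<in> span (ideal_forms M d \<union> ideal_forms N d)" by blast
  qed auto
  moreover have "span (ideal_forms M d \<union> ideal_forms N d) \<subseteq> ideal_forms (span (M \<union> N)) d"
    using ideal_forms_mono[of M "span (M \<union> N)" d] ideal_forms_mono[of N "span (M \<union> N)" d]
      span_superset[of "M \<union> N"] by (intro span_minimal) auto
  ultimately show ?thesis using Suc by auto
qed

lemma ideal_forms_single:
  assumes "r \<in> ideal_forms (span {x}) (Suc d)"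
  shows "\<exists>g\<in>forms d. r = x * g"
proof -
  have "product (span {x}) (forms d) \<subseteq> (\<lambda>g. x * g) ` forms d"
  proof (rule product_subset)
    show "subspace ((\<lambda>g. x * g) ` forms d)"
    proof (rule subspaceI)
      show "0 \<in> (\<lambda>g. x * g) ` forms d" using subspace_0[OF subspace_forms[of d]] by force
      show "a + b \<in> (\<lambda>g. x * g) ` forms d"
        if "a \<in> (\<lambda>g. x * g) ` forms d" "b \<in> (\<lambda>g. x * g) ` forms d" for a b
        using that subspace_add[OF subspace_forms[of d]] by (force simp: distrib_left[symmetric])
      show "scale c a \<in> (\<lambda>g. x * g) ` forms d" if "a \<in> (\<lambda>g. x * g) ` forms d" for c a
        using that subspace_scale[OF subspace_forms[of d]]
        by (force simp: scale_mult_right[symmetric])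
    qed
  next
    fix a b assume "a \<in> span {x}" "b \<in> forms d"
    then obtain c where "a = scale c x" by (auto simp: span_singleton)
    then have "a * b = x * scale c b" by (simp add: scale_mult_left scale_mult_right)
    then show "a * b \<in> (\<lambda>g. x * g) ` forms d"
      using \<open>b \<in> forms d\<close> subspace_scale[OF subspace_forms] by blast
  qed
  then show ?thesis using assms by auto
qed

lemma product_forms_subset: "(\<And>i. i < m \<Longrightarrow> F i \<subseteq> L) \<Longrightarrow> product_forms F m d \<subseteq> forms d"
proof (induction m arbitrary: d)
  case (Suc m)
  then show ?case
    by (cases d) (simp_all add: subspace_0 span_zero product_mono)
qed simp

lemma product_forms_subset_ideal:
  assumes "\<And>i. i < m \<Longrightarrow> F i \<subseteq> L" "i < m"
  shows "product_forms F m d \<subseteq> ideal_forms (F i) d"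
  using assms
proof (induction m arbitrary: d)
  case (Suc m)
  show ?case
  proof (cases d)
    case (Suc d')
    show ?thesis
    proof (cases "i = m")
      case True
      then show ?thesis using Suc product_forms_subset[of m F d'] Suc.prems
        by (simp add: product_mono)
    next
      case False
      then have "product_forms F m d' \<subseteq> ideal_forms (F i) d'" using Suc.IH Suc.prems by simp
      moreover have "F i \<subseteq> L" "F m \<subseteq> L" using Suc.prems by auto
      ultimately have "product (F m) (product_forms F m d') \<subseteq> ideal_forms (F i) (Suc d')"
        by (intro product_subset[OF subspace_ideal_forms] mult_ideal_forms) auto
      then show ?thesis using Suc by simp
    qed
  qed simp
qed simp

text \<open>
  Multiplying out: enlarging the factors by \<open>N\<close> changes the product only by multiples of elements of \<open>N\<close>.
  So a product of ideals in the quotient modulo \<open>N\<close> lifts to the product of the ideals upstairs.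
\<close>

lemma product_forms_perturb:
  assumes "N \<subseteq> L" "\<And>i. i < m \<Longrightarrow> F i \<subseteq> L" "\<And>i. i < m \<Longrightarrow> F' i \<subseteq> span (F i \<union> N)"
  shows "product_forms F' m d \<subseteq> span (product_forms F m d \<union> ideal_forms N d)"
  using assms(2,3)
proof (induction m arbitrary: d)
  case 0
  then show ?case by (auto intro: span_base)
next
  case (Suc m)
  show ?case
  proof (cases d)
    case (Suc d')
    let ?Z = "span (product_forms F (Suc m) d \<union> ideal_forms N d)"
    have Z: "subspace ?Z" by simp
    have *: "a * b \<in> ?Z" if "a \<in> F m \<union> N" "b \<in> product_forms F m d' \<union> ideal_forms N d'" for a b
    proof (cases "b \<in> ideal_forms N d'")
      case True
      then have "a * b \<in> ideal_forms N (Suc d')"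
        using that(1) Suc.prems(1)[of m] assms(1) by (intro mult_ideal_forms) auto
      then show ?thesis using Suc by (auto intro: span_base simp del: ideal_forms.simps)
    next
      case False
      then have b: "b \<in> product_forms F m d'" using that by blast
      then have "b \<in> forms d'" using product_forms_subset[of m F d'] Suc.prems(1) by auto
      then show ?thesis
        using that(1) b Suc by (auto intro!: span_base productI)
    qed
    have "product (F' m) (product_forms F' m d') \<subseteq> ?Z"
    proof (rule product_subset[OF Z])
      fix a b assume "a \<in> F' m" "b \<in> product_forms F' m d'"
      then have "a \<in> span (F m \<union> N)" "b \<in> span (product_forms F m d' \<union> ideal_forms N d')"
        using Suc.IH[of d', OF Suc.prems] Suc.prems(2)[of m] by auto
      then have "a * b \<in> product (F m \<union> N) (product_forms F m d' \<union> ideal_forms N d')"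
        by (rule mult_mem_product_of_span)
      then show "a * b \<in> ?Z" using product_subset[OF Z *] by blast
    qed
    then show ?thesis using Suc by simp
  qed (simp add: subspace_0 span_zero)
qed

end

section \<open>Transversal intersections are products in high degree\<close>

text \<open>
  What is used of a polynomial ring beyond its grading: ideals generated by linear forms are such that a
  linear form outside the ideal is a nonzerodivisor modulo it. For \<open>M = {0}\<close> this includes that nonzero
  linear forms are not zero divisors.
\<close>

locale polynomial_like_algebra = graded_algebra scale L
  for scale :: "'a::field \<Rightarrow> 'b::comm_ring_1 \<Rightarrow> 'b" and L +
  assumes infinite_field: "infinite (UNIV :: 'a set)"
    and one_neq_zero: "(1 :: 'b) \<noteq> 0"
    and regular: "subspace M \<Longrightarrow> M \<subseteq> L \<Longrightarrow> x \<in> L \<Longrightarrow> x \<notin> M \<Longrightarrow> y \<in> forms d \<Longrightarrow>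
      x * y \<in> ideal_forms M (Suc d) \<Longrightarrow> y \<in> ideal_forms M d"
begin

text \<open>
  Transversality in the quotient by \<open>M\<close>, expressed without forming the quotient. The numbers \<open>e i\<close> are
  prescribed and may exceed the dimension of \<open>F i\<close> modulo \<open>M\<close> when \<open>F i = L\<close>. This slack is what makes
  the condition stable under enlarging \<open>M\<close>: the dimension of \<open>F i = L\<close> modulo \<open>M\<close> drops, but \<open>e i\<close>
  need not be adjusted.
\<close>

definition rel_transversal :: "'b set \<Rightarrow> (nat \<Rightarrow> 'b set) \<Rightarrow> (nat \<Rightarrow> nat) \<Rightarrow> nat \<Rightarrow> bool" where
  "rel_transversal M F e m \<longleftrightarrow>
     subspace M \<and> M \<subseteq> L \<and> (\<forall>i<m. subspace (F i) \<and> M \<subseteq> F i \<and> F i \<subseteq> L) \<and>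
     (\<forall>S\<subseteq>{..<m}. dim (span (M \<union> \<Union>(F ` S))) = min (dim L) (dim M + sum e S))"

lemma rel_transversal_weaken:
  assumes "rel_transversal M F e m" "k \<le> m"
  shows "rel_transversal M F e k"
proof -
  have "S \<subseteq> {..<k} \<Longrightarrow> S \<subseteq> {..<m}" for S using assms(2) by auto
  moreover have "i < k \<Longrightarrow> i < m" for i using assms(2) by simp
  ultimately show ?thesis using assms(1) unfolding rel_transversal_def by presburger
qed

lemma fin_dim_sub_L: "U \<subseteq> L \<Longrightarrow> fin_dim U"
  using fin_dim_L fin_dim_subset by blast

lemma rel_transversal_member:
  assumes "rel_transversal M F e m" "i < m"
  shows "dim (F i) = min (dim L) (dim M + e i)"
proof -
  have "M \<union> F i = F i" using assms unfolding rel_transversal_def by blast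
  moreover have "dim (span (M \<union> \<Union>(F ` {i}))) = min (dim L) (dim M + sum e {i})"
    using assms unfolding rel_transversal_def by (metis empty_subsetI insert_subset lessThan_iff)
  ultimately show ?thesis by simp
qed

text \<open>
  A generic \<open>x\<close> in \<open>F m\<close> avoids every proper subspace \<open>J S\<close> spanned by \<open>M\<close> and the \<open>F i\<close> with \<open>i \<in> S\<close>,
  \<open>m \<notin> S\<close>. This is possible as \<open>F m \<subseteq> J S\<close> would mean that adding \<open>F m\<close> leaves the dimension
  \<open>min (dim L) (dim M + sum e S)\<close> unchanged, although \<open>e m > 0\<close>. Adding \<open>x\<close> to \<open>M\<close> raises the dimension of
  each proper \<open>J S\<close> with \<open>m \<notin> S\<close> by one and leaves those with \<open>m \<in> S\<close> alone, so transversality persists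
  with \<open>e m\<close> lowered by one.
\<close>

lemma rel_transversal_generic_hyperplane:
  assumes T: "rel_transversal M F e (Suc m)" and em: "e m = Suc k" and proper: "M \<noteq> L"
  obtains x where "x \<in> F m" "x \<notin> M" "\<And>i. i < m \<Longrightarrow> F i \<noteq> L \<Longrightarrow> x \<notin> F i"
    "rel_transversal (span (insert x M)) (\<lambda>i. span (insert x (F i))) (e(m := k)) (Suc m)"
proof -
  define J where "J S = span (M \<union> \<Union>(F ` S))" for S
  have M: "subspace M" "M \<subseteq> L" and F: "\<And>i. i < Suc m \<Longrightarrow> subspace (F i) \<and> M \<subseteq> F i \<and> F i \<subseteq> L"
    and dimJ: "\<And>S. S \<subseteq> {..<Suc m} \<Longrightarrow> dim (J S) = min (dim L) (dim M + sum e S)"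
    using T unfolding rel_transversal_def J_def by auto
  have JL: "J S \<subseteq> L" if "S \<subseteq> {..<Suc m}" for S
  proof -
    have "M \<union> \<Union>(F ` S) \<subseteq> L" using M F that by fastforce
    then show ?thesis unfolding J_def using subspace_L by (simp add: span_minimal)
  qed
  have sJ: "subspace (J S)" for S unfolding J_def by simp
  have less: "dim M + sum e S < dim L" if "S \<subseteq> {..<Suc m}" "J S \<noteq> L" for S
  proof (rule ccontr)
    assume "\<not> ?thesis"
    then have "dim L \<le> dim (J S)" using dimJ[OF that(1)] by simp
    then show False
      using fin_dim_dim_equal[OF JL[OF that(1)] fin_dim_L sJ subspace_L] that(2) by blast
  qed
  have "\<exists>x\<in>F m. \<forall>W\<in>J ` {S. S \<subseteq> {..<m} \<and> J S \<noteq> L}. x \<notin> W"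
  proof (rule avoid_finitely_many_subspaces[OF infinite_field])
    show "finite (J ` {S. S \<subseteq> {..<m} \<and> J S \<noteq> L})" by simp
    show "subspace (F m)" using F by simp
    fix W assume "W \<in> J ` {S. S \<subseteq> {..<m} \<and> J S \<noteq> L}"
    then obtain S where S: "S \<subseteq> {..<m}" "J S \<noteq> L" "W = J S" by blast
    have "\<not> F m \<subseteq> J S"
    proof
      assume sub: "F m \<subseteq> J S"
      have S': "insert m S \<subseteq> {..<Suc m}" "S \<subseteq> {..<Suc m}" "m \<notin> S"
        using S(1) by force+
      have finS: "finite S" using S(1) finite_subset by blast
      have "M \<union> \<Union>(F ` insert m S) \<subseteq> J S"
        using sub unfolding J_def by (auto intro: span_base)
      then have "J (insert m S) \<subseteq> J S" unfolding J_def[of "insert m S"] using sJ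
        by (simp add: span_minimal)
      then have "dim (J (insert m S)) \<le> dim (J S)"
        using fin_dim_dim_mono fin_dim_sub_L JL S'(2) by blast
      then show False
        using dimJ[OF S'(1)] dimJ[OF S'(2)] less[OF S'(2) S(2)] S'(3) finS em by simp
    qed
    then show "subspace W \<and> \<not> F m \<subseteq> W" using S(3) sJ by blast
  qed
  then obtain x where x1: "x \<in> F m" and x0: "\<forall>W\<in>J ` {S. S \<subseteq> {..<m} \<and> J S \<noteq> L}. x \<notin> W"
    by metis
  have x2: "x \<notin> J S" if "S \<subseteq> {..<m}" "J S \<noteq> L" for S using x0 that by simp
  note x = x1 x2
  have xL: "x \<in> L" using x(1) F by blast
  have "J {} = M" unfolding J_def using M by simp
  then have xM: "x \<notin> M" using x(2)[of "{}"] proper by simp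
  have xF: "x \<notin> F i" if "i < m" "F i \<noteq> L" for i
  proof -
    have "M \<union> F i = F i" using F[of i] that by auto
    then have "J {i} = F i" unfolding J_def using F[of i] that by simp
    then show ?thesis using x(2)[of "{i}"] that by simp
  qed
  let ?M = "span (insert x M)" and ?F = "\<lambda>i. span (insert x (F i))" and ?e = "e(m := k)"
  have dM: "dim ?M = Suc (dim M)" using dim_span_insert[OF M(1) fin_dim_sub_L[OF M(2)] xM] .
  have J': "span (?M \<union> \<Union>(?F ` S)) = span (insert x (J S))" for S
  proof
    have "?M \<subseteq> span (insert x (J S))" "?F i \<subseteq> span (insert x (J S))" if "i \<in> S" for i
      using that unfolding J_def by (auto intro!: span_mono intro: span_base)
    moreover have "?M \<subseteq> span (insert x (J S))"
      unfolding J_def by (auto intro!: span_mono intro: span_base)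
    ultimately show "span (?M \<union> \<Union>(?F ` S)) \<subseteq> span (insert x (J S))"
      by (intro span_minimal) auto
    have "x \<in> ?M" by (simp add: span_base)
    moreover have "J S \<subseteq> span (?M \<union> \<Union>(?F ` S))"
      unfolding J_def using span_superset[of "insert x M"] span_superset[of "insert x (F _)"]
      by (intro span_mono) blast
    ultimately show "span (insert x (J S)) \<subseteq> span (?M \<union> \<Union>(?F ` S))"
      by (intro span_minimal) (auto intro: span_base)
  qed
  have dJ': "dim (span (insert x (J S))) = min (dim L) (dim ?M + sum ?e S)"
    if S: "S \<subseteq> {..<Suc m}" for S
  proof -
    have finS: "finite S" using S finite_subset by blast
    show ?thesis
    proof (cases "m \<in> S")
      case True
      then have "x \<in> J S" unfolding J_def using x(1) by (auto intro!: span_base)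
      then have "span (insert x (J S)) = J S" using sJ by (simp add: insert_absorb)
      moreover have "sum e S = Suc (sum ?e S)"
        using True finS em by (simp add: sum.remove[of S m])
      ultimately show ?thesis using dimJ[OF S] dM by simp
    next
      case False
      then have e: "sum ?e S = sum e S" by (intro sum.cong) auto
      show ?thesis
      proof (cases "J S = L")
        case True
        then have "span (insert x (J S)) = L"
          using xL subspace_L by (simp add: insert_absorb)
        then show ?thesis using dimJ[OF S] dM True e by simp
      next
        case False
        have "S \<subseteq> {..<m}" using S \<open>m \<notin> S\<close> less_Suc_eq by auto
        then have "x \<notin> J S" using x(2) False by blast
        then have "dim (span (insert x (J S))) = Suc (dim (J S))"
          using dim_span_insert[OF sJ] fin_dim_sub_L[OF JL[OF S]] by blast
        then show ?thesis using dimJ[OF S] dM e less[OF S False] by simp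
      qed
    qed
  qed
  have "rel_transversal ?M ?F ?e (Suc m)"
    unfolding rel_transversal_def
  proof (intro conjI allI impI)
    show "?M \<subseteq> L" using xL M subspace_L by (intro span_minimal) auto
    show "?F i \<subseteq> L" if "i < Suc m" for i using xL F[OF that] subspace_L by (intro span_minimal) auto
    show "?M \<subseteq> ?F i" if "i < Suc m" for i using F[OF that] by (intro span_mono) auto
    show "dim (span (?M \<union> \<Union>(?F ` S))) = min (dim L) (dim ?M + sum ?e S)"
      if "S \<subseteq> {..<Suc m}" for S
      using dJ'[OF that] J' by simp
  qed (rule subspace_span)+
  then show ?thesis using that x(1) xM xF by blast
qed

text \<open>
  The outer induction is on the number of ideals, the inner one on \<open>e m\<close>. For a generic \<open>x\<close> the inner
  hypothesis, applied modulo \<open>x\<close>, writes \<open>f\<close> as \<open>u + x * g\<close> with \<open>u\<close> in the wanted space. Then \<open>x * g\<close>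
  lies in the ideals of \<open>F i\<close> for \<open>i < m\<close>, and so does \<open>g\<close>, because \<open>x\<close> is a nonzerodivisor modulo each
  of them with \<open>F i \<noteq> L\<close>. The outer hypothesis applies to \<open>g\<close>, whose degree is still at least the
  number of remaining ideals; this is where the bound \<open>m \<le> d\<close> comes from.
\<close>

lemma intersection_subset_product:
  assumes "rel_transversal M F e m" "m \<le> d" "f \<in> forms d"
    "\<And>i. i < m \<Longrightarrow> f \<in> ideal_forms (F i) d"
  shows "f \<in> span (product_forms F m d \<union> ideal_forms M d)"
  using assms
proof (induction m arbitrary: M F e d f)
  case 0
  then show ?case by (simp add: span_base)
next
  case (Suc m)
  note IH = Suc.IH
  have "f \<in> span (product_forms F (Suc m) d \<union> ideal_forms M d)"
    if "e m = k" "rel_transversal M F e (Suc m)" "\<And>i. i < Suc m \<Longrightarrow> f \<in> ideal_forms (F i) d" for k M F e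
    using that
  proof (induction k arbitrary: M F e)
    case 0
    have M: "subspace M" "M \<subseteq> F m" "F m \<subseteq> L" "subspace (F m)"
      using 0(2) unfolding rel_transversal_def by auto
    have "dim (F m) \<le> dim M"
      using rel_transversal_member[OF 0(2), of m] 0(1) by simp
    then have "F m = M"
      using fin_dim_dim_equal[OF M(2) fin_dim_sub_L[OF M(3)] M(1,4)] by simp
    then show ?case using 0(3)[of m] by (auto intro: span_base)
  next
    case (Suc k)
    note T = \<open>rel_transversal M F e (Suc m)\<close> and fF = Suc.prems(3)
    have M: "subspace M" "M \<subseteq> L" and F: "\<And>i. i < Suc m \<Longrightarrow> subspace (F i) \<and> M \<subseteq> F i \<and> F i \<subseteq> L"
      using T unfolding rel_transversal_def by auto
    show ?case
    proof (cases "M = L")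
      case True
      then have "F m = M" using F[of m] by auto
      then show ?thesis using fF[of m] by (auto intro: span_base)
    next
      case False
      obtain x where x: "x \<in> F m" "x \<notin> M" "\<And>i. i < m \<Longrightarrow> F i \<noteq> L \<Longrightarrow> x \<notin> F i"
        and T': "rel_transversal (span (insert x M)) (\<lambda>i. span (insert x (F i))) (e(m := k)) (Suc m)"
        using rel_transversal_generic_hyperplane[OF T Suc.prems(1) False] by blast
      let ?M = "span (insert x M)" and ?F = "\<lambda>i. span (insert x (F i))"
      obtain d' where d: "d = Suc d'" and d': "m \<le> d'" using \<open>Suc m \<le> d\<close> Suc_le_D by auto
      have xL: "x \<in> L" using x(1) F by blast
      let ?P = "product_forms F (Suc m) d" and ?X = "ideal_forms (span {x}) d"
      let ?U = "span (?P \<union> ideal_forms M d)"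
      have "f \<in> span (product_forms ?F (Suc m) d \<union> ideal_forms ?M d)"
      proof (rule Suc.IH[OF _ T'])
        fix i assume i: "i < Suc m"
        have "F i \<subseteq> ?F i" by (auto intro: span_base)
        then show "f \<in> ideal_forms (?F i) d" using fF[OF i] ideal_forms_mono by blast
      qed simp
      moreover have "product_forms ?F (Suc m) d \<subseteq> span (?P \<union> ?X)"
      proof (rule product_forms_perturb)
        show "span {x} \<subseteq> L" using xL subspace_L by (simp add: span_minimal)
        show "F i \<subseteq> L" if "i < Suc m" for i using F that by blast
        show "?F i \<subseteq> span (F i \<union> span {x})" for i
          by (rule span_minimal) (auto intro: span_base)
      qed
      moreover have "ideal_forms ?M d \<subseteq> span (ideal_forms M d \<union> ?X)"
      proof -
        have "?M \<subseteq> span (M \<union> span {x})" by (rule span_minimal) (auto intro: span_base)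
        then show ?thesis using ideal_forms_mono ideal_forms_span_Un by metis
      qed
      moreover have "span (?P \<union> ?X) \<subseteq> span (?U \<union> ?X)" "span (ideal_forms M d \<union> ?X) \<subseteq> span (?U \<union> ?X)"
        by (intro span_mono; auto intro: span_base)+
      ultimately have "f \<in> span (span (?U \<union> ?X))"
        by (meson Un_least span_mono subsetD subset_trans)
      then have "f \<in> span (?U \<union> ?X)" by (simp only: span_span)
      then obtain u r where ur: "f = u + r" "u \<in> ?U" "r \<in> ?X"
        by (subst (asm) span_Un_subspaces) auto
      then obtain g where g: "g \<in> forms d'" "r = x * g"
        using ideal_forms_single d by blast
      have gF: "g \<in> ideal_forms (F i) d'" if i: "i < m" for i
      proof (cases "F i = L")
        \<comment> \<open>The irrelevant ideal contains all forms of positive degree, and \<open>d' \<ge> m > i \<ge> 0\<close>.\<close>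
        case True
        then show ?thesis using g(1) ideal_forms_L[of d'] i d' by simp
      next
        case neq: False
        have "?P \<subseteq> ideal_forms (F i) d"
          using product_forms_subset_ideal[of "Suc m" F i d] F i by auto
        moreover have "ideal_forms M d \<subseteq> ideal_forms (F i) d"
          using ideal_forms_mono F[of i] i by simp
        ultimately have "?U \<subseteq> ideal_forms (F i) d" by (intro span_minimal) auto
        then have "f - u \<in> ideal_forms (F i) d"
          using fF[of i] i ur(2) by (intro subspace_diff) auto
        then have "x * g \<in> ideal_forms (F i) (Suc d')" using ur(1) g(2) d by simp
        then show ?thesis
          using regular[of "F i" x g d'] F[of i] i x(3)[OF i neq] g(1) xL by auto
      qed
      have "g \<in> span (product_forms F m d' \<union> ideal_forms M d')"
        using IH[OF rel_transversal_weaken[OF T] d' g(1) gF] by simp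
      then obtain p h where ph: "g = p + h" "p \<in> product_forms F m d'" "h \<in> ideal_forms M d'"
        by (subst (asm) span_Un_subspaces) auto
      have "x * p \<in> ?P" using x(1) ph(2) d by (simp add: productI)
      moreover have "x * h \<in> ideal_forms M d" using mult_ideal_forms[OF M(2) xL ph(3)] d by simp
      ultimately have "r \<in> ?U" using g(2) ph(1)
        by (auto simp: distrib_left intro!: span_add intro: span_base)
      then show ?thesis using ur span_add by blast
    qed
  qed
  from this[OF refl Suc.prems(1,4)] show ?case .
qed

end

section \<open>Dimension of the intersection\<close>

text \<open>The number of monomials of degree \<open>d\<close> in \<open>r\<close> variables.\<close>

definition polynomial_ring_dim :: "nat \<Rightarrow> nat \<Rightarrow> int" where
  "polynomial_ring_dim r d =
     (case r of 0 \<Rightarrow> (if d = 0 then 1 else 0) | Suc r' \<Rightarrow> int ((d + r') choose r'))"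

text \<open>
  The linear functional that sends \<open>u\<^sup>k\<close> to the Hilbert function at \<open>d\<close> of a polynomial ring in \<open>n - k\<close>
  variables. Powers with \<open>k \<ge> n\<close> are sent to zero, which is the correct value for no variables only if
  \<open>d > 0\<close>.
\<close>

definition hilbert_functional :: "nat \<Rightarrow> nat \<Rightarrow> int poly \<Rightarrow> int" where
  "hilbert_functional n d p = (\<Sum>j<n. coeff p j * polynomial_ring_dim (n - j) d)"

lemma hilbert_functional_diff:
  "hilbert_functional n d (p - q) = hilbert_functional n d p - hilbert_functional n d q"
  by (simp add: hilbert_functional_def left_diff_distrib sum_subtractf)

lemma hilbert_functional_monom:
  assumes "k < n"
  shows "hilbert_functional n d (monom 1 k) = polynomial_ring_dim (n - k) d"
proof -
  have "hilbert_functional n d (monom 1 k) =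
      (\<Sum>j<n. if j = k then polynomial_ring_dim (n - k) d else 0)"
    unfolding hilbert_functional_def by (intro sum.cong) auto
  then show ?thesis using assms by simp
qed

lemma hilbert_functional_monom_mult_high:
  "n \<le> k \<Longrightarrow> hilbert_functional n d (monom 1 k * p) = 0"
  unfolding hilbert_functional_def by (intro sum.neutral) (simp add: coeff_monom_mult)

lemma hilbert_functional_monom_min:
  "hilbert_functional n d (monom 1 (min n k) * p) = hilbert_functional n d (monom 1 k * p)"
  by (cases "k < n") (auto simp: hilbert_functional_monom_mult_high min_def)

context polynomial_like_algebra
begin

lemma ideal_forms_zero: "ideal_forms {0} d = {0}"
proof (cases d)
  case (Suc d')
  have "product {0} (forms d') \<subseteq> {0}"
    by (rule product_subset) (auto simp: subspace_single_0)
  then show ?thesis using Suc subspace_0[OF subspace_product, of "{0}" "forms d'"] by auto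
qed simp

lemma mult_forms_inj:
  assumes "x \<in> L" "x \<noteq> 0"
  shows "inj_on ((*) x) (forms d)"
proof (rule inj_onI)
  fix y z assume "y \<in> forms d" "z \<in> forms d" "x * y = x * z"
  then have "y - z \<in> forms d" "x * (y - z) \<in> ideal_forms {0} (Suc d)"
    unfolding ideal_forms_zero by (auto simp: subspace_diff right_diff_distrib)
  moreover have "{0} \<subseteq> L" using subspace_L subspace_0 by simp
  ultimately have "y - z \<in> ideal_forms {0} d"
    using regular[of "{0}" x "y - z" d] assms subspace_single_0 by simp
  then show "y = z" by (simp add: ideal_forms_zero)
qed

lemma dim_mult_image:
  assumes "x \<in> L" "x \<noteq> 0" "subspace U" "U \<subseteq> forms d"
  shows "dim ((*) x ` U) = dim U"
proof -
  interpret p: vector_space_pair scale scale ..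
  have lin: "Vector_Spaces.linear scale scale ((*) x)"
    by (simp add: Vector_Spaces.linear_iff vector_space_axioms distrib_left scale_mult_right)
  obtain B where B: "finite B" "independent B" "span B = U" "card B = dim U"
    using fin_dim_basis fin_dim_subset assms fin_dim_forms by metis
  have inj: "inj_on ((*) x) (span B)"
    using mult_forms_inj[OF assms(1,2)] B(3) assms(4) inj_on_subset by blast
  have "independent ((*) x ` B)"
    using p.linear_independent_injective_image[OF lin B(2) inj] .
  moreover have "span ((*) x ` B) = (*) x ` U"
    using p.linear_span_image[OF lin, of B] B(3) by simp
  moreover have "card ((*) x ` B) = card B"
    using inj span_superset by (intro card_image) (blast intro: inj_on_subset)
  ultimately show ?thesis using B(4) dim_span_eq_card_independent by metis
qed

lemma ideal_forms_insert:
  "ideal_forms (span (insert x M)) (Suc d) = span (ideal_forms M (Suc d) \<union> (*) x ` forms d)"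
proof -
  have "ideal_forms {x} (Suc d) = (*) x ` forms d"
  proof
    show "ideal_forms {x} (Suc d) \<subseteq> (*) x ` forms d"
      using ideal_forms_single[of _ x d] ideal_forms_mono[of "{x}" "span {x}" "Suc d"]
      by (auto simp: span_base simp del: ideal_forms.simps)
    show "(*) x ` forms d \<subseteq> ideal_forms {x} (Suc d)" by (auto intro: productI)
  qed
  then show ?thesis using ideal_forms_span_Un[of M "{x}" "Suc d"] by simp
qed

text \<open>
  Exactness of multiplication by \<open>x\<close>: modulo the ideal of \<open>M\<close> it is injective with cokernel the quotient
  by the ideal of \<open>M\<close> and \<open>x\<close>.
\<close>

lemma dim_ideal_forms_insert:
  assumes M: "subspace M" "M \<subseteq> L" and x: "x \<in> L" "x \<notin> M"
  shows "dim (ideal_forms (span (insert x M)) (Suc d)) + dim (ideal_forms M d) =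
    dim (ideal_forms M (Suc d)) + dim (forms d)"
proof -
  let ?Y = "(*) x ` forms d"
  have x0: "x \<noteq> 0" using x(2) M(1) subspace_0 by blast
  have Y: "subspace ?Y" "?Y \<subseteq> forms (Suc d)"
  proof -
    interpret p: vector_space_pair scale scale ..
    have "Vector_Spaces.linear scale scale ((*) x)"
      by (simp add: Vector_Spaces.linear_iff vector_space_axioms distrib_left scale_mult_right)
    then show "subspace ?Y" using p.linear_subspace_image subspace_forms by blast
    show "?Y \<subseteq> forms (Suc d)" using x(1) by (auto intro: productI)
  qed
  have int: "ideal_forms M (Suc d) \<inter> ?Y = (*) x ` ideal_forms M d"
  proof
    show "ideal_forms M (Suc d) \<inter> ?Y \<subseteq> (*) x ` ideal_forms M d"
      using regular[OF M x] by (auto simp del: ideal_forms.simps)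
    show "(*) x ` ideal_forms M d \<subseteq> ideal_forms M (Suc d) \<inter> ?Y"
      using mult_ideal_forms[OF M(2) x(1)] ideal_forms_subset[OF M(2), of d]
      by (auto simp del: ideal_forms.simps)
  qed
  have "dim (span (ideal_forms M (Suc d) \<union> ?Y)) + dim (ideal_forms M (Suc d) \<inter> ?Y) =
      dim (ideal_forms M (Suc d)) + dim ?Y"
    using Y fin_dim_subset[OF Y(2)] fin_dim_ideal_forms[OF M(2), of "Suc d"]
    by (intro dim_span_Un_Int) (auto simp del: ideal_forms.simps forms.simps)
  then show ?thesis
    unfolding int ideal_forms_insert
    using dim_mult_image[OF x(1) x0 subspace_ideal_forms ideal_forms_subset[OF M(2)]]
      dim_mult_image[OF x(1) x0 subspace_forms order_refl] by simp
qed

lemma dim_zero [simp]: "dim {0} = 0"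
  using dim_span_eq_card_independent[OF independent_empty] by (simp add: span_empty)

lemma dim_forms_0: "dim (forms 0) = 1"
  using dim_eq_card_independent[of "{1}"] one_neq_zero by simp

text \<open>
  Pascal's rule, read off from the exactness of multiplication by a linear form. The induction goes
  downwards from \<open>M = L\<close>, where the quotient is concentrated in degree \<open>0\<close>.
\<close>

lemma dim_quotient_ideal_forms:
  assumes "subspace M" "M \<subseteq> L"
  shows "int (dim (forms d)) = int (dim (ideal_forms M d)) + polynomial_ring_dim (dim L - dim M) d"
  using assms
proof (induction "dim L - dim M" arbitrary: M d)
  case 0
  have "M = L"
    using fin_dim_dim_equal[OF 0(3) fin_dim_L 0(2) subspace_L] 0(1) by simp
  then show ?case
    using dim_forms_0 ideal_forms_L[of d]
    by (cases "d = 0") (simp_all add: polynomial_ring_dim_def)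
next
  case (Suc r)
  then have "M \<noteq> L" by auto
  then obtain x where x: "x \<in> L" "x \<notin> M" using Suc.prems by blast
  let ?M = "span (insert x M)"
  have M': "subspace ?M" "?M \<subseteq> L"
    using x Suc.prems subspace_L by (simp_all add: span_minimal)
  note hyp = Suc.hyps(1) and prems = Suc.prems and codim = Suc.hyps(2)[symmetric]
  have r: "r = dim L - dim ?M"
    using dim_span_insert[OF Suc.prems(1) fin_dim_sub_L[OF Suc.prems(2)] x(2)] Suc(2) by simp
  show ?case
  proof (induction d)
    case 0
    show ?case using dim_forms_0 codim
      by (simp add: polynomial_ring_dim_def)
  next
    case (Suc d)
    have pascal: "polynomial_ring_dim (Suc r) (Suc d) =
        polynomial_ring_dim (Suc r) d + polynomial_ring_dim r (Suc d)"
      by (simp add: polynomial_ring_dim_def split: nat.split)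
    show ?case
      using Suc.IH hyp[OF r M', of "Suc d"] pascal
        dim_ideal_forms_insert[OF prems x, of d] codim r[symmetric]
      by (simp del: forms.simps ideal_forms.simps)
  qed
qed

text \<open>
  Modulo \<open>F m\<close> the intersection of the other ideals maps onto the intersection of their images. An
  element of the latter is a product in the quotient, and products lift. Only the \<open>m\<close> remaining ideals
  enter, so degrees \<open>d \<ge> m\<close> suffice.
\<close>

lemma span_intersection_ideal:
  assumes T: "rel_transversal M F e (Suc m)" and d: "m \<le> d"
  shows "span ((forms d \<inter> (\<Inter>i<m. ideal_forms (F i) d)) \<union> ideal_forms (F m) d) =
    forms d \<inter> (\<Inter>i<m. ideal_forms (span (F m \<union> F i)) d)" (is "span (?A \<union> ?I) = ?A'")
    and "rel_transversal (F m) (\<lambda>i. span (F m \<union> F i)) e m"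
proof -
  have F: "\<And>i. i < Suc m \<Longrightarrow> subspace (F i) \<and> M \<subseteq> F i \<and> F i \<subseteq> L"
    and dimJ: "\<And>S. S \<subseteq> {..<Suc m} \<Longrightarrow> dim (span (M \<union> \<Union>(F ` S))) = min (dim L) (dim M + sum e S)"
    using T unfolding rel_transversal_def by auto
  show T': "rel_transversal (F m) (\<lambda>i. span (F m \<union> F i)) e m"
    unfolding rel_transversal_def
  proof (intro conjI allI impI)
    show "span (F m \<union> F i) \<subseteq> L" if "i < m" for i
      using F[of i] F[of m] that subspace_L by (intro span_minimal) auto
    show "F m \<subseteq> span (F m \<union> F i)" if "i < m" for i
      using span_superset[of "F m \<union> F i"] by simp
    show "subspace (F m)" "F m \<subseteq> L" using F[of m] by simp_all
    fix S assume S: "S \<subseteq> {..<m}"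
    then have S': "insert m S \<subseteq> {..<Suc m}" "m \<notin> S" by force+
    have finS: "finite S" using S finite_subset by blast
    have eq: "span (F m \<union> (\<Union>i\<in>S. span (F m \<union> F i))) = span (M \<union> \<Union>(F ` insert m S))"
    proof
      have "span (F m \<union> F i) \<subseteq> span (M \<union> \<Union>(F ` insert m S))" if "i \<in> S" for i
        using that by (intro span_mono) auto
      then show "span (F m \<union> (\<Union>i\<in>S. span (F m \<union> F i))) \<subseteq> span (M \<union> \<Union>(F ` insert m S))"
        by (intro span_minimal) (auto intro: span_base)
      show "span (M \<union> \<Union>(F ` insert m S)) \<subseteq> span (F m \<union> (\<Union>i\<in>S. span (F m \<union> F i)))"
        using F[of m] by (intro span_mono) (auto intro: span_base)
    qed
    have "dim (F m) = min (dim L) (dim M + e m)"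
      using rel_transversal_member[OF T] by blast
    then have "min (dim L) (dim M + sum e (insert m S)) = min (dim L) (dim (F m) + sum e S)"
      using S'(2) finS by (simp add: min_def)
    then show "dim (span (F m \<union> (\<Union>i\<in>S. span (F m \<union> F i)))) = min (dim L) (dim (F m) + sum e S)"
      by (simp only: eq dimJ[OF S'(1)])
  qed (rule subspace_span)
  have Iforms: "?I \<subseteq> forms d" using ideal_forms_subset[of "F m" d] F[of m] by simp
  show "span (?A \<union> ?I) = ?A'"
  proof
    have "?I \<subseteq> ideal_forms (span (F m \<union> F i)) d" "ideal_forms (F i) d \<subseteq> ideal_forms (span (F m \<union> F i)) d" for i
      by (intro ideal_forms_mono; auto intro: span_base)+
    then have "?A \<union> ?I \<subseteq> ?A'" using Iforms by blast
    moreover have "subspace ?A'"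
      by (auto intro!: subspace_inter subspace_Inter)
    ultimately show "span (?A \<union> ?I) \<subseteq> ?A'" by (rule span_minimal)
    show "?A' \<subseteq> span (?A \<union> ?I)"
    proof
      fix f assume f: "f \<in> ?A'"
      have "f \<in> span (product_forms (\<lambda>i. span (F m \<union> F i)) m d \<union> ?I)"
        using f by (intro intersection_subset_product[OF T' d]) auto
      moreover have "product_forms (\<lambda>i. span (F m \<union> F i)) m d \<subseteq> span (product_forms F m d \<union> ?I)"
        using F by (intro product_forms_perturb) (auto simp: Un_commute)
      moreover have "product_forms F m d \<subseteq> ?A"
      proof (intro Int_greatest INT_greatest)
        show "product_forms F m d \<subseteq> forms d"
          by (rule product_forms_subset) (use F in simp)
        show "product_forms F m d \<subseteq> ideal_forms (F i) d" if "i \<in> {..<m}" for i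
          by (rule product_forms_subset_ideal) (use F that in simp_all)
      qed
      then have "span (product_forms F m d \<union> ?I) \<subseteq> span (?A \<union> ?I)" by (intro span_mono) auto
      moreover have "?I \<subseteq> span (?A \<union> ?I)" by (auto intro: span_base)
      ultimately have "f \<in> span (span (?A \<union> ?I))" by (meson Un_least span_mono subsetD subset_trans)
      then show "f \<in> span (?A \<union> ?I)" by (simp only: span_span)
    qed
  qed
qed

text \<open>
  Splitting off the last ideal, \<open>dim (A \<inter> I) = dim A + dim I - dim (A + I)\<close>, reduces the claim to the
  arrangement of the first \<open>m\<close> ideals and to its restriction modulo \<open>F m\<close>. They contribute the terms
  \<open>1\<close> and \<open>- monom 1 (e m)\<close> of the last factor.
\<close>

lemma dim_intersection_rel:
  assumes "rel_transversal M F e m" "m \<le> d" "0 < d"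
  shows "int (dim (forms d \<inter> (\<Inter>i<m. ideal_forms (F i) d))) =
    int (dim (ideal_forms M d)) +
    hilbert_functional (dim L) d (monom 1 (dim M) * (\<Prod>i<m. 1 - monom 1 (e i)))"
  using assms
proof (induction m arbitrary: M F)
  case 0
  then have M: "subspace M" "M \<subseteq> L" unfolding rel_transversal_def by auto
  have "hilbert_functional (dim L) d (monom 1 (dim M)) = polynomial_ring_dim (dim L - dim M) d"
    using hilbert_functional_monom hilbert_functional_monom_mult_high[of "dim L" "dim M" d 1] 0
    by (cases "dim M < dim L") (auto simp: polynomial_ring_dim_def)
  then show ?case using dim_quotient_ideal_forms[OF M, of d] by simp
next
  case (Suc m)
  let ?n = "dim L" and ?Q = "\<Prod>i<m. 1 - monom 1 (e i) :: int poly"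
  let ?A = "forms d \<inter> (\<Inter>i<m. ideal_forms (F i) d)"
  have T: "rel_transversal M F e (Suc m)" and d: "m \<le> d" using Suc by auto
  have Fm: "subspace (F m)" "F m \<subseteq> L" using T unfolding rel_transversal_def by auto
  have A: "subspace ?A" by (auto intro!: subspace_inter subspace_Inter)
  have "dim (span (?A \<union> ideal_forms (F m) d)) + dim (?A \<inter> ideal_forms (F m) d) =
      dim ?A + dim (ideal_forms (F m) d)"
    using A fin_dim_ideal_forms[OF Fm(2), of d]
    by (intro dim_span_Un_Int) (auto intro: fin_dim_subset[OF _ fin_dim_forms])
  moreover have "?A \<inter> ideal_forms (F m) d = forms d \<inter> (\<Inter>i<Suc m. ideal_forms (F i) d)"
    by (auto simp: lessThan_Suc)
  moreover have "int (dim (span (?A \<union> ideal_forms (F m) d))) = int (dim (ideal_forms (F m) d)) +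
      hilbert_functional ?n d (monom 1 (dim M + e m) * ?Q)"
    unfolding span_intersection_ideal(1)[OF T d]
    using Suc.IH[OF span_intersection_ideal(2)[OF T d] d Suc.prems(3)]
      rel_transversal_member[OF T, of m] by (simp add: hilbert_functional_monom_min)
  moreover have "int (dim ?A) = int (dim (ideal_forms M d)) + hilbert_functional ?n d (monom 1 (dim M) * ?Q)"
    using Suc.IH[OF rel_transversal_weaken[OF T] d Suc.prems(3)] by simp
  moreover have "monom 1 (dim M) * (\<Prod>i<Suc m. 1 - monom 1 (e i)) =
      monom 1 (dim M) * ?Q - monom 1 (dim M + e m) * ?Q"
    by (simp add: algebra_simps mult_monom)
  ultimately show ?case by (simp add: hilbert_functional_diff)
qed

lemma dim_intersection:
  assumes "rel_transversal {0} F e m" "m \<le> d" "0 < d \<or> 0 < dim L"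
  shows "int (dim (forms d \<inter> (\<Inter>i<m. ideal_forms (F i) d))) =
    hilbert_functional (dim L) d (\<Prod>i<m. 1 - monom 1 (e i))"
proof -
  show ?thesis
  proof (cases "d = 0")
    case True
    then show ?thesis
      using assms(2,3) dim_forms_0 hilbert_functional_monom[of 0 "dim L" 0]
      by (auto simp: polynomial_ring_dim_def monom_0 one_pCons split: nat.split_asm)
  next
    case False
    then show ?thesis
      using dim_intersection_rel[OF assms(1,2)] by (simp add: ideal_forms_zero monom_0 one_pCons)
  qed
qed

end

section \<open>Polynomial functions over an infinite field\<close>

definition fun_scale :: "'a::field \<Rightarrow> ('x \<Rightarrow> 'a) \<Rightarrow> 'x \<Rightarrow> 'a" where
  "fun_scale c f = (\<lambda>x. c * f x)"

lemma fun_scale_apply: "fun_scale c f x = c * f x"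
  by (simp add: fun_scale_def)

interpretation fun_space: commutative_algebra fun_scale
  by unfold_locales (simp_all add: fun_eq_iff fun_scale_apply algebra_simps)

definition coordinate :: "'v \<Rightarrow> ('v \<Rightarrow> 'a) \<Rightarrow> 'a" where
  "coordinate b v = v b"

text \<open>
  Over an infinite field the polynomial ring is represented by functions on the space of points, with the
  coordinate functions as variables. Zero sets then replace computations with ideals.
\<close>

locale polynomial_functions =
  fixes B :: "'v set" and L :: "(('v \<Rightarrow> 'a::field) \<Rightarrow> 'a) set"
  assumes finite_B: "finite B"
    and L_eq: "L = fun_space.span (coordinate ` B)"
    and infinite_UNIV: "infinite (UNIV :: 'a set)"
begin

sublocale graded_algebra fun_scale L
  by unfold_locales (simp_all add: L_eq finite_B fun_space.fin_dim_span fun_space.fin_dim_finite)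

lemma linear_on_line:
  assumes "x \<in> L"
  shows "x (\<lambda>b. v b + t * w b) = x v + t * x w"
  using assms unfolding L_eq
proof (induction rule: fun_space.span_induct)
  case base
  show ?case by (rule fun_space.subspaceI) (simp_all add: fun_scale_apply algebra_simps)
next
  case (step f)
  then show ?case by (auto simp: coordinate_def)
qed

lemma polynomial_on_line:
  assumes "y \<in> forms d"
  shows "\<exists>q. \<forall>t. y (\<lambda>b. v b + t * w b) = poly q t"
  using assms
proof (induction d arbitrary: y)
  case 0
  then obtain c where "y = fun_scale c 1" by (auto simp: fun_space.span_singleton)
  then show ?case by (intro exI[of _ "[:c:]"]) (simp add: fun_scale_apply)
next
  case (Suc d)
  let ?Z = "{y. \<exists>q. \<forall>t. y (\<lambda>b. v b + t * w b) = poly q t}"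
  have "fun_space.product L (forms d) \<subseteq> ?Z"
  proof (rule fun_space.product_subset)
    show "fun_space.subspace ?Z"
    proof (rule fun_space.subspaceI)
      show "0 \<in> ?Z" by (auto intro!: exI[of _ 0])
      show "f + g \<in> ?Z" if "f \<in> ?Z" "g \<in> ?Z" for f g
      proof -
        obtain p q where "\<forall>t. f (\<lambda>b. v b + t * w b) = poly p t" "\<forall>t. g (\<lambda>b. v b + t * w b) = poly q t"
          using \<open>f \<in> ?Z\<close> \<open>g \<in> ?Z\<close> by blast
        then show ?thesis by (auto intro!: exI[of _ "p + q"])
      qed
      show "fun_scale c f \<in> ?Z" if "f \<in> ?Z" for c f
      proof -
        obtain p where "\<forall>t. f (\<lambda>b. v b + t * w b) = poly p t" using \<open>f \<in> ?Z\<close> by blast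
        then show ?thesis by (auto intro!: exI[of _ "smult c p"] simp: fun_scale_apply)
      qed
    qed
    fix x z assume "x \<in> L" "z \<in> forms d"
    then obtain q where "\<forall>t. z (\<lambda>b. v b + t * w b) = poly q t" using Suc.IH by blast
    then show "x * z \<in> ?Z"
      using linear_on_line[OF \<open>x \<in> L\<close>, of v _ w]
      by (auto intro!: exI[of _ "[:x v, x w:] * q"] simp: algebra_simps)
  qed
  then show ?case using Suc.prems by auto
qed

lemma ideal_forms_vanish:
  assumes "f \<in> ideal_forms M d" "\<And>x. x \<in> M \<Longrightarrow> x w = 0"
  shows "f w = 0"
proof (cases d)
  case (Suc d')
  have "fun_space.product M (forms d') \<subseteq> {f. f w = 0}"
    by (rule fun_space.product_subset)
      (auto intro!: fun_space.subspaceI simp: assms(2) fun_scale_apply)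
  then show ?thesis using assms(1) Suc by auto
qed (use assms in simp)

text \<open>
  A linear projection \<open>P\<close> of \<open>L\<close> along \<open>M\<close> induces a map \<open>\<pi>\<close> of the points, whose coordinates are the values
  of the images of the coordinate functions. Composition with \<open>\<pi>\<close> is \<open>P\<close> on linear forms, and \<open>\<pi>\<close> maps
  into the zero set of \<open>M\<close>.
\<close>

lemma projection_onto_zero_set:
  assumes M: "fun_space.subspace M" "M \<subseteq> L"
  obtains \<pi> :: "('v \<Rightarrow> 'a) \<Rightarrow> 'v \<Rightarrow> 'a" where
    "\<And>x v. x \<in> M \<Longrightarrow> x (\<pi> v) = 0"
    "\<And>x. x \<in> L \<Longrightarrow> x - (\<lambda>v. x (\<pi> v)) \<in> M"
proof -
  interpret p: vector_space_pair fun_scale fun_scale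
    by unfold_locales
  have finM: "fun_space.fin_dim M" using M(2) fin_dim_L fun_space.fin_dim_subset by blast
  obtain C where C: "finite C" "fun_space.independent C" "fun_space.span C = M"
    using fun_space.fin_dim_basis[OF finM M(1)] by metis
  have CL: "C \<subseteq> L" using C(3) M(2) fun_space.span_superset by blast
  obtain D where D: "C \<subseteq> D" "fun_space.independent D" "fun_space.span D = L"
    using fun_space.fin_dim_basis_extend[OF fin_dim_L subspace_L CL C(2)] by metis
  obtain P where P: "Vector_Spaces.linear fun_scale fun_scale P"
      "\<forall>x\<in>D. P x = (if x \<in> C then 0 else x)"
    using p.linear_independent_extend[OF D(2), of "\<lambda>x. if x \<in> C then 0 else x"] by metis
  have add: "P (x + y) = P x + P y" and scale: "P (fun_scale c x) = fun_scale c (P x)" for x y c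
    using P(1) by (auto simp: Vector_Spaces.linear_iff)
  have zero: "P 0 = 0" using scale[of 0 0] by (simp add: fun_eq_iff fun_scale_apply)
  have PM: "P x = 0" if "x \<in> M" for x
    using that unfolding C(3)[symmetric]
  proof (induction rule: fun_space.span_induct)
    case base
    show ?case by (rule fun_space.subspaceI) (simp_all add: add scale zero fun_scale_apply fun_eq_iff)
  next
    case (step x)
    then show ?case using P(2) D(1) by auto
  qed
  have PL: "x - P x \<in> M" if "x \<in> L" for x
    using that unfolding D(3)[symmetric]
  proof (induction rule: fun_space.span_induct)
    case base
    show ?case
    proof (rule fun_space.subspaceI)
      show "0 \<in> {x. x - P x \<in> M}" using M(1) fun_space.subspace_0 by (simp add: zero)
      show "x + y \<in> {x. x - P x \<in> M}" if "x \<in> {x. x - P x \<in> M}" "y \<in> {x. x - P x \<in> M}" for x y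
        using fun_space.subspace_add[OF M(1), of "x - P x" "y - P y"] that by (simp add: add algebra_simps)
      show "fun_scale c x \<in> {x. x - P x \<in> M}" if "x \<in> {x. x - P x \<in> M}" for c x
        using fun_space.subspace_scale[OF M(1), of "x - P x" c] that
        by (simp add: scale fun_space.scale_right_diff_distrib)
    qed
  next
    case (step x)
    have "C \<subseteq> M" using C(3) fun_space.span_superset by blast
    show ?case
    proof (cases "x \<in> C")
      case True
      then have "x - P x = x" using step P(2) by (simp only: if_True diff_zero)
      then show ?thesis using True \<open>C \<subseteq> M\<close> by auto
    next
      case False
      then have "x - P x = 0" using step P(2) by (simp only: if_False diff_self)
      then show ?thesis using M(1) fun_space.subspace_0 by (simp only: mem_Collect_eq)
    qed
  qed
  define \<pi> :: "('v \<Rightarrow> 'a) \<Rightarrow> 'v \<Rightarrow> 'a" where "\<pi> v = (\<lambda>b. P (coordinate b) v)" for v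
  have \<pi>: "x (\<pi> v) = P x v" if "x \<in> L" for x v
    using that unfolding L_eq
  proof (induction rule: fun_space.span_induct)
    case base
    show ?case by (rule fun_space.subspaceI) (simp_all add: add scale zero fun_scale_apply)
  next
    case (step x)
    then show ?case by (auto simp: \<pi>_def coordinate_def[of _ "\<lambda>b. P (coordinate b) v"])
  qed
  show ?thesis
  proof (rule that[of \<pi>])
    show "x (\<pi> v) = 0" if "x \<in> M" for x v using \<pi>[of x v] PM[OF that] M(2) that by auto
    show "x - (\<lambda>v. x (\<pi> v)) \<in> M" if "x \<in> L" for x
      using PL[OF that] \<pi>[OF that] by simp
  qed
qed

text \<open>With \<open>\<pi>\<close> from the previous lemma, a form that vanishes on the zero set of \<open>M\<close> lies in the ideal of \<open>M\<close>.\<close>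

lemma ideal_forms_if_vanish:
  assumes M: "M \<subseteq> L"
    and \<pi>: "\<And>x. x \<in> L \<Longrightarrow> x - (\<lambda>v. x (\<pi> v)) \<in> M"
    and y: "y \<in> forms d"
  shows "y - (\<lambda>v. y (\<pi> v)) \<in> ideal_forms M d"
  using y
proof (induction d arbitrary: y)
  case 0
  then obtain c where "y = fun_scale c 1" by (auto simp: fun_space.span_singleton)
  then have "y - (\<lambda>v. y (\<pi> v)) = 0" by (simp add: fun_eq_iff fun_scale_apply)
  then show ?case by (simp only: ideal_forms.simps singletonI)
next
  case (Suc d)
  let ?Z = "{y. y - (\<lambda>v. y (\<pi> v)) \<in> ideal_forms M (Suc d)}"
  note I = subspace_ideal_forms[of M "Suc d"]
  have "fun_space.product L (forms d) \<subseteq> ?Z"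
  proof (rule fun_space.product_subset)
    show "fun_space.subspace ?Z"
    proof (rule fun_space.subspaceI)
      have "(0 :: ('v \<Rightarrow> 'a) \<Rightarrow> 'a) - (\<lambda>v. 0 (\<pi> v)) = 0" by (simp add: fun_eq_iff)
      then show "0 \<in> ?Z" using fun_space.subspace_0[OF I] by (simp only: mem_Collect_eq)
      show "f + g \<in> ?Z" if "f \<in> ?Z" "g \<in> ?Z" for f g
      proof -
        have "(f + g) - (\<lambda>v. (f + g) (\<pi> v)) = (f - (\<lambda>v. f (\<pi> v))) + (g - (\<lambda>v. g (\<pi> v)))"
          by (simp add: fun_eq_iff)
        then show ?thesis using fun_space.subspace_add[OF I] that by (simp only: mem_Collect_eq)
      qed
      show "fun_scale c f \<in> ?Z" if "f \<in> ?Z" for c f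
      proof -
        have "fun_scale c f - (\<lambda>v. fun_scale c f (\<pi> v)) = fun_scale c (f - (\<lambda>v. f (\<pi> v)))"
          by (simp add: fun_eq_iff fun_scale_apply algebra_simps)
        then show ?thesis using fun_space.subspace_scale[OF I] that by (simp only: mem_Collect_eq)
      qed
    qed
    fix x z assume xz: "x \<in> L" "z \<in> forms d"
    define x' where "x' = (\<lambda>v. x (\<pi> v))"
    have x'M: "x - x' \<in> M" using \<pi>[OF xz(1)] by (simp add: x'_def)
    then have x': "x' \<in> L"
      using fun_space.subspace_diff[OF subspace_L xz(1), of "x - x'"] M by auto
    have eq: "x * z - (\<lambda>v. (x * z) (\<pi> v)) = (x - x') * z + x' * (z - (\<lambda>v. z (\<pi> v)))"
      by (simp add: x'_def fun_eq_iff algebra_simps)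
    have "(x - x') * z \<in> ideal_forms M (Suc d)" using x'M xz(2) by (simp add: fun_space.productI)
    moreover have "x' * (z - (\<lambda>v. z (\<pi> v))) \<in> ideal_forms M (Suc d)"
      by (rule mult_ideal_forms[OF M x' Suc.IH[OF xz(2)]])
    ultimately show "x * z \<in> ?Z" using fun_space.subspace_add[OF I] by (simp only: eq mem_Collect_eq)
  qed
  then show ?case using Suc.prems unfolding forms.simps by blast
qed

text \<open>
  If \<open>x * y\<close> lies in the ideal of \<open>M\<close>, it vanishes on the zero set of \<open>M\<close>. Move from a point \<open>w\<close> of this
  subspace in a direction \<open>w0\<close> of the subspace along which \<open>x\<close> is not constant: all but one point of the
  line have \<open>x \<noteq> 0\<close>, so \<open>y\<close> vanishes there, and \<open>y\<close> is a polynomial along the line.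
\<close>

sublocale polynomial_like_algebra fun_scale L
proof unfold_locales
  show "infinite (UNIV :: 'a set)" by (rule infinite_UNIV)
  show "(1 :: ('v \<Rightarrow> 'a) \<Rightarrow> 'a) \<noteq> 0" by (simp add: fun_eq_iff)
next
  fix M x y d
  assume M: "fun_space.subspace M" "M \<subseteq> L" and x: "x \<in> L" "x \<notin> M"
    and y: "y \<in> forms d" and xy: "x * y \<in> ideal_forms M (Suc d)"
  obtain \<pi> :: "('v \<Rightarrow> 'a) \<Rightarrow> 'v \<Rightarrow> 'a" where
    \<pi>: "\<And>x v. x \<in> M \<Longrightarrow> x (\<pi> v) = 0"
    "\<And>x. x \<in> L \<Longrightarrow> x - (\<lambda>v. x (\<pi> v)) \<in> M"
    using projection_onto_zero_set[OF M] by metis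
  have "\<exists>v. x (\<pi> v) \<noteq> 0"
  proof (rule ccontr)
    assume "\<not> ?thesis"
    then have "x - (\<lambda>v. x (\<pi> v)) = x" by (simp add: fun_eq_iff)
    then show False using \<pi>(2)[OF x(1)] x(2) by simp
  qed
  then obtain w0 where w0: "x w0 \<noteq> 0" "\<And>z. z \<in> M \<Longrightarrow> z w0 = 0" using \<pi>(1) by blast
  have vanish: "y w = 0" if w: "\<And>z. z \<in> M \<Longrightarrow> z w = 0" for w
  proof -
    obtain q where q: "\<And>t. y (\<lambda>b. w b + t * w0 b) = poly q t"
      using polynomial_on_line[OF y, of w w0] by blast
    have "poly q t = 0" if "t \<noteq> - x w / x w0" for t
    proof -
      have "z (\<lambda>b. w b + t * w0 b) = 0" if "z \<in> M" for z
        using linear_on_line[OF subsetD[OF M(2) that], of w t w0] w[OF that] w0(2)[OF that] by simp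
      then have "(x * y) (\<lambda>b. w b + t * w0 b) = 0"
        using ideal_forms_vanish[OF xy] by blast
      then have "(x w + t * x w0) * poly q t = 0"
        using linear_on_line[OF x(1)] q by simp
      moreover have "x w + t * x w0 \<noteq> 0"
        using \<open>t \<noteq> _\<close> w0(1) by (auto simp: field_simps add_eq_0_iff)
      ultimately show ?thesis by simp
    qed
    then have "UNIV - {- x w / x w0} \<subseteq> {t. poly q t = 0}" by blast
    then have "infinite {t. poly q t = 0}"
      using infinite_UNIV by (meson finite.emptyI finite_Diff2 finite.insertI finite_subset)
    then have "q = 0" using poly_roots_finite by blast
    then show ?thesis using q[of 0] by simp
  qed
  have "y - (\<lambda>v. y (\<pi> v)) = y" using vanish \<pi>(1) by (simp add: fun_eq_iff)
  then show "y \<in> ideal_forms M d" using ideal_forms_if_vanish[OF M(2) \<pi>(2) y] by simp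
qed

end

section \<open>Extension of scalars\<close>

lemma base_expansion_inject:
  fixes a b :: "nat \<Rightarrow> nat"
  assumes "\<And>i. i < n \<Longrightarrow> a i < D" "\<And>i. i < n \<Longrightarrow> b i < D"
    and "(\<Sum>i<n. a i * D ^ i) = (\<Sum>i<n. b i * D ^ i)"
  shows "\<forall>i<n. a i = b i"
  using assms
proof (induction n arbitrary: a b)
  case (Suc n)
  have split: "(\<Sum>i<Suc n. c i * D ^ i) = c 0 + D * (\<Sum>i<n. c (Suc i) * D ^ i)" for c :: "nat \<Rightarrow> nat"
    unfolding sum.lessThan_Suc_shift by (simp add: sum_distrib_left mult_ac)
  have eq: "a 0 + D * (\<Sum>i<n. a (Suc i) * D ^ i) = b 0 + D * (\<Sum>i<n. b (Suc i) * D ^ i)"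
    using Suc.prems(3) unfolding split .
  have less: "a 0 < D" "b 0 < D" using Suc.prems by auto
  have "a 0 = b 0" using arg_cong[OF eq, of "\<lambda>x. x mod D"] less by simp
  moreover have "(\<Sum>i<n. a (Suc i) * D ^ i) = (\<Sum>i<n. b (Suc i) * D ^ i)"
    using eq less calculation by simp
  have "\<forall>i<n. a (Suc i) = b (Suc i)"
  proof (rule Suc.IH)
    show "a (Suc i) < D" "b (Suc i) < D" if "i < n" for i using Suc.prems(1,2) that by simp_all
  qed fact
  ultimately show ?case using less_Suc_eq_0_disj by auto
qed simp

interpretation mpoly: commutative_algebra "scale_mpoly :: 'k::field \<Rightarrow> ('v, 'k) mpoly \<Rightarrow> ('v, 'k) mpoly"
  by (intro commutative_algebra.intro subspaces.intro vector_space_scale_mpoly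
      commutative_algebra_axioms.intro) (simp only: scale_mpoly_def mult.assoc)

lemma lookup_scale_mpoly: "Poly_Mapping.lookup (scale_mpoly c p) t = c * Poly_Mapping.lookup p t"
  unfolding scale_mpoly_def mult_map_scale_conv_mult[symmetric] by (simp add: map.rep_eq when_def)

lemma mpoly_expansion:
  fixes p :: "('v, 'k::field) mpoly"
  shows "p = (\<Sum>t\<in>Poly_Mapping.keys p. Poly_Mapping.single t (Poly_Mapping.lookup p t))"
proof (rule poly_mapping_eqI)
  fix s
  have "(\<Sum>t\<in>Poly_Mapping.keys p. Poly_Mapping.lookup p t when t = s) = Poly_Mapping.lookup p s"
    by (cases "s \<in> Poly_Mapping.keys p")
      (auto simp: when_def sum.If_cases in_keys_iff)
  then show "Poly_Mapping.lookup p s =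
      Poly_Mapping.lookup (\<Sum>t\<in>Poly_Mapping.keys p. Poly_Mapping.single t (Poly_Mapping.lookup p t)) s"
    by (simp add: lookup_sum lookup_single)
qed

lemma sum_fun_apply: "(\<Sum>i\<in>A. f i) x = (\<Sum>i\<in>A. f i x)"
  for f :: "'i \<Rightarrow> 'x \<Rightarrow> 'a::comm_monoid_add"
  by (induction A rule: infinite_finite_induct) simp_all

lemma subspace_coord_ring:
  fixes B :: "'v set"
  shows "mpoly.subspace (coord_ring B :: ('v, 'k::field) mpoly set)"
proof (rule mpoly.subspaceI)
  show "x + y \<in> coord_ring B" if "x \<in> coord_ring B" "y \<in> coord_ring B" for x y :: "('v, 'k) mpoly"
    using that Poly_Mapping.keys_add[of x y] unfolding coord_ring_def by blast
  show "scale_mpoly c x \<in> coord_ring B" if "x \<in> coord_ring B" for c and x :: "('v, 'k) mpoly"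
    using that unfolding coord_ring_def by (auto simp: in_keys_iff lookup_scale_mpoly)
qed (simp add: coord_ring_def)

lemma coord_ring_mult:
  assumes "p \<in> coord_ring B" "q \<in> coord_ring B"
  shows "p * q \<in> coord_ring B"
  unfolding coord_ring_def
proof safe
  fix t b assume "t \<in> Poly_Mapping.keys (p * q)" and b: "b \<in> Poly_Mapping.keys t"
  then obtain s s' where "t = s + s'" "s \<in> Poly_Mapping.keys p" "s' \<in> Poly_Mapping.keys q"
    using keys_mult[of p q] by blast
  then show "b \<in> B" using assms b Poly_Mapping.keys_add[of s s'] unfolding coord_ring_def by blast
qed

definition variable :: "'v \<Rightarrow> ('v, 'k::field) mpoly" where
  "variable b = Poly_Mapping.single (Poly_Mapping.single b 1) 1"

definition mpoly_linear_forms :: "'v set \<Rightarrow> ('v, 'k::field) mpoly set" where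
  "mpoly_linear_forms B = mpoly.span (variable ` B)"

lemma mpoly_linear_forms_subset: "mpoly_linear_forms B \<subseteq> coord_ring B"
  unfolding mpoly_linear_forms_def
  by (rule mpoly.span_minimal[OF _ subspace_coord_ring]) (auto simp: coord_ring_def variable_def)

locale scalar_extension =
  fixes emb :: "'k::field \<Rightarrow> 'a::field" and B :: "'v set"
  assumes finite_B: "finite B"
    and infinite_UNIV: "infinite (UNIV :: 'a set)"
    and emb_add: "emb (x + y) = emb x + emb y"
    and emb_mult: "emb (x * y) = emb x * emb y"
    and emb_1: "emb 1 = 1"
begin

sublocale src: graded_algebra scale_mpoly "mpoly_linear_forms B :: ('v, 'k) mpoly set"
  by unfold_locales
    (simp_all add: mpoly_linear_forms_def finite_B mpoly.fin_dim_span mpoly.fin_dim_finite)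

sublocale tgt: polynomial_functions B "fun_space.span (coordinate ` B :: (('v \<Rightarrow> 'a) \<Rightarrow> 'a) set)"
  by unfold_locales (simp_all add: finite_B infinite_UNIV)

lemma emb_0 [simp]: "emb 0 = 0"
  using emb_add[of 0 0] by (metis add.right_neutral add_left_cancel)

definition monomial :: "('v \<Rightarrow>\<^sub>0 nat) \<Rightarrow> ('v \<Rightarrow> 'a) \<Rightarrow> 'a" where
  "monomial t v = (\<Prod>b\<in>B. v b ^ Poly_Mapping.lookup t b)"

lemma monomial_add: "monomial (s + t) v = monomial s v * monomial t v"
  by (simp add: monomial_def lookup_add power_add prod.distrib)

text \<open>
  Kronecker substitution: replacing the \<open>i\<close>-th variable by \<open>x\<close> to the power \<open>D ^ i\<close>, for \<open>D\<close> larger than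
  all exponents, turns distinct monomials into distinct powers of \<open>x\<close>.
\<close>

lemma monomials_independent:
  assumes T: "finite T" "\<And>t. t \<in> T \<Longrightarrow> Poly_Mapping.keys t \<subseteq> B"
    and zero: "\<And>v. (\<Sum>t\<in>T. c t * monomial t v) = 0"
    and t: "t \<in> T"
  shows "c t = 0"
proof -
  obtain f where f: "bij_betw f {..<card B} B" 
    using ex_bij_betw_nat_finite[OF finite_B] by (auto simp: atLeast0LessThan)
  define D where "D = Suc (\<Sum>t\<in>T. \<Sum>b\<in>B. Poly_Mapping.lookup t b)"
  define N where "N t = (\<Sum>i<card B. Poly_Mapping.lookup t (f i) * D ^ i)" for t
  have bound: "Poly_Mapping.lookup s b < D" if "s \<in> T" "b \<in> B" for s b
  proof -
    have "Poly_Mapping.lookup s b \<le> (\<Sum>b\<in>B. Poly_Mapping.lookup s b)"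
      using that finite_B by (intro member_le_sum) auto
    also have "\<dots> \<le> (\<Sum>t\<in>T. \<Sum>b\<in>B. Poly_Mapping.lookup t b)"
      using that T by (intro member_le_sum[of s T "\<lambda>t. \<Sum>b\<in>B. Poly_Mapping.lookup t b"]) auto
    finally show ?thesis unfolding D_def by simp
  qed
  have inj: "s = s'" if "s \<in> T" "s' \<in> T" "N s = N s'" for s s'
  proof -
    have fB: "f i \<in> B" if "i < card B" for i using f that by (auto simp: bij_betw_def)
    have digits: "\<forall>i<card B. Poly_Mapping.lookup s (f i) = Poly_Mapping.lookup s' (f i)"
      using that(3) bound that(1,2) fB unfolding N_def by (intro base_expansion_inject) auto
    have eqB: "Poly_Mapping.lookup s b = Poly_Mapping.lookup s' b" if "b \<in> B" for b
    proof -
      have "b \<in> f ` {..<card B}" using f that unfolding bij_betw_def by simp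
      then obtain i where "i < card B" "b = f i" by blast
      then show ?thesis using digits by simp
    qed
    show ?thesis
    proof (rule poly_mapping_eqI)
      fix b show "Poly_Mapping.lookup s b = Poly_Mapping.lookup s' b"
      proof (cases "b \<in> B")
        case False
        then have "b \<notin> Poly_Mapping.keys s" "b \<notin> Poly_Mapping.keys s'"
          using T(2) that(1,2) by blast+
        then show ?thesis by (simp add: in_keys_iff)
      qed (rule eqB)
    qed
  qed
  define g where "g = the_inv_into {..<card B} f"
  have g: "g (f i) = i" if "i < card B" for i
    using f that by (simp add: g_def the_inv_into_f_f bij_betw_def)
  have eval: "monomial s (\<lambda>b. x ^ (D ^ g b)) = x ^ N s" for s x
  proof -
    have "monomial s (\<lambda>b. x ^ (D ^ g b)) = (\<Prod>b\<in>B. x ^ (Poly_Mapping.lookup s b * D ^ g b))"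
      by (simp add: monomial_def power_mult[symmetric] mult.commute)
    also have "\<dots> = (\<Prod>i<card B. x ^ (Poly_Mapping.lookup s (f i) * D ^ g (f i)))"
      using prod.reindex_bij_betw[OF f, of "\<lambda>b. x ^ (Poly_Mapping.lookup s b * D ^ g b)"] by simp
    also have "\<dots> = (\<Prod>i<card B. x ^ (Poly_Mapping.lookup s (f i) * D ^ i))"
      by (intro prod.cong) (auto simp: g)
    finally show ?thesis by (simp add: N_def power_sum)
  qed
  define p where "p = (\<Sum>s\<in>T. monom (c s) (N s))"
  have "poly p x = 0" for x
    using zero[of "\<lambda>b. x ^ (D ^ g b)"] by (simp add: p_def poly_sum poly_monom eval)
  then have "infinite {x. poly p x = 0}" using infinite_UNIV by simp
  then have "p = 0" using poly_roots_finite by blast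
  then have "0 = coeff p (N t)" by simp
  also have "\<dots> = (\<Sum>s\<in>T. if s = t then c t else 0)"
    unfolding p_def coeff_sum using inj t by (intro sum.cong) auto
  also have "\<dots> = c t" using T(1) t by simp
  finally show ?thesis by simp
qed

text \<open>The polynomial function over the larger field that is given by a polynomial over the smaller one.\<close>

definition poly_fun :: "('v, 'k) mpoly \<Rightarrow> ('v \<Rightarrow> 'a) \<Rightarrow> 'a" where
  "poly_fun p v = (\<Sum>t\<in>Poly_Mapping.keys p. emb (Poly_Mapping.lookup p t) * monomial t v)"

lemma poly_fun_superset:
  assumes "finite T" "Poly_Mapping.keys p \<subseteq> T"
  shows "poly_fun p v = (\<Sum>t\<in>T. emb (Poly_Mapping.lookup p t) * monomial t v)"
  unfolding poly_fun_def using assms by (intro sum.mono_neutral_left) (auto simp: in_keys_iff)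

lemma poly_fun_add: "poly_fun (p + q) = poly_fun p + poly_fun q"
proof
  fix v
  let ?T = "Poly_Mapping.keys p \<union> Poly_Mapping.keys q"
  have "poly_fun (p + q) v = (\<Sum>t\<in>?T. emb (Poly_Mapping.lookup (p + q) t) * monomial t v)"
    using Poly_Mapping.keys_add[of p q] by (intro poly_fun_superset) auto
  also have "\<dots> = poly_fun p v + poly_fun q v"
    by (simp add: poly_fun_superset[of ?T] lookup_add emb_add algebra_simps sum.distrib)
  finally show "poly_fun (p + q) v = (poly_fun p + poly_fun q) v" by simp
qed

lemma poly_fun_0 [simp]: "poly_fun 0 = 0"
  by (simp add: poly_fun_def fun_eq_iff)

lemma poly_fun_sum: "poly_fun (sum f A) = (\<Sum>i\<in>A. poly_fun (f i))"
  by (induction A rule: infinite_finite_induct) (simp_all add: poly_fun_add)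

lemma poly_fun_single: "poly_fun (Poly_Mapping.single t c) v = emb c * monomial t v"
  using poly_fun_superset[of "{t}" "Poly_Mapping.single t c" v] by simp

lemma poly_fun_mult: "poly_fun (p * q) = poly_fun p * poly_fun q"
proof
  fix v
  let ?s = "\<lambda>p t. Poly_Mapping.single t (Poly_Mapping.lookup p t)"
  have "p * q = (\<Sum>s\<in>Poly_Mapping.keys p. \<Sum>t\<in>Poly_Mapping.keys q. ?s p s * ?s q t)"
    by (subst mpoly_expansion[of p], subst mpoly_expansion[of q], rule sum_product)
  then have "poly_fun (p * q) v = poly_fun (\<Sum>s\<in>Poly_Mapping.keys p. \<Sum>t\<in>Poly_Mapping.keys q. ?s p s * ?s q t) v"
    by simp
  also have "\<dots> = (\<Sum>s\<in>Poly_Mapping.keys p. \<Sum>t\<in>Poly_Mapping.keys q. poly_fun (?s p s * ?s q t) v)"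
    by (simp add: poly_fun_sum sum_fun_apply)
  also have "\<dots> = (\<Sum>s\<in>Poly_Mapping.keys p. \<Sum>t\<in>Poly_Mapping.keys q.
      (emb (Poly_Mapping.lookup p s) * monomial s v) * (emb (Poly_Mapping.lookup q t) * monomial t v))"
    by (simp add: mult_single poly_fun_single monomial_add emb_mult mult_ac)
  also have "\<dots> = poly_fun p v * poly_fun q v" by (simp add: poly_fun_def sum_product)
  finally show "poly_fun (p * q) v = (poly_fun p * poly_fun q) v" by simp
qed

lemma poly_fun_1: "poly_fun 1 = 1"
proof
  fix v show "poly_fun 1 v = 1 v"
    using poly_fun_single[of 0 1 v] by (simp add: monomial_def emb_1)
qed

lemma poly_fun_scale: "poly_fun (scale_mpoly c p) = fun_scale (emb c) (poly_fun p)"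
proof
  fix v show "poly_fun (scale_mpoly c p) v = fun_scale (emb c) (poly_fun p) v"
    unfolding scale_mpoly_def poly_fun_mult times_fun_apply
    by (simp add: poly_fun_single fun_scale_apply monomial_def)
qed

lemma poly_fun_variable:
  assumes "b \<in> B"
  shows "poly_fun (variable b) = coordinate b"
proof
  fix v
  have "monomial (Poly_Mapping.single b 1) v = (\<Prod>b'\<in>B. if b' = b then v b else 1)"
    unfolding monomial_def by (intro prod.cong) (auto simp: lookup_single when_def)
  also have "\<dots> = v b" using assms finite_B by simp
  finally show "poly_fun (variable b) v = coordinate b v"
    by (simp add: variable_def poly_fun_single emb_1 coordinate_def)
qed

text \<open>
  The image of \<open>U \<otimes> K'\<close>, where \<open>K'\<close> is the larger field. As \<open>poly_fun\<close> is additive, multiplicative and preserves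
  linear independence, this operation preserves dimensions and commutes with all operations on subspaces
  that occur in the arrangement ideal.
\<close>

definition extension :: "('v, 'k) mpoly set \<Rightarrow> (('v \<Rightarrow> 'a) \<Rightarrow> 'a) set" where
  "extension U = fun_space.span (poly_fun ` U)"

lemma subspace_extension [simp]: "fun_space.subspace (extension U)"
  by (simp add: extension_def)

lemma extension_mono: "U \<subseteq> W \<Longrightarrow> extension U \<subseteq> extension W"
  unfolding extension_def by (intro fun_space.span_mono image_mono)

lemma poly_fun_span: "p \<in> mpoly.span U \<Longrightarrow> poly_fun p \<in> extension U"
proof (induction rule: mpoly.span_induct)
  case base
  show ?case
    using fun_space.subspace_0[OF subspace_extension] fun_space.subspace_add[OF subspace_extension]
      fun_space.subspace_scale[OF subspace_extension]
    by (intro mpoly.subspaceI) (auto simp only: mem_Collect_eq poly_fun_0 poly_fun_add poly_fun_scale)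
next
  case (step x)
  then show ?case unfolding extension_def by (blast intro: fun_space.span_base)
qed

lemma extension_span: "extension (mpoly.span U) = extension U"
proof
  show "extension (mpoly.span U) \<subseteq> extension U"
    using poly_fun_span unfolding extension_def[of "mpoly.span U"]
    by (intro fun_space.span_minimal) auto
  show "extension U \<subseteq> extension (mpoly.span U)"
    by (intro extension_mono mpoly.span_superset)
qed

lemma extension_Un: "extension (mpoly.span (U \<union> W)) = fun_space.span (extension U \<union> extension W)"
  unfolding extension_span
  by (simp add: extension_def image_Un fun_space.span_Un fun_space.span_span)

lemma exists_separating_functional:
  assumes "a \<noteq> 0"
  shows "\<exists>\<phi> :: 'a \<Rightarrow> 'k. \<phi> a \<noteq> 0 \<and> (\<forall>x y. \<phi> (x + y) = \<phi> x + \<phi> y) \<and> (\<forall>c x. \<phi> (emb c * x) = c * \<phi> x)"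
proof -
  interpret v1: vector_space "\<lambda>c x. emb c * x"
    by unfold_locales (simp_all add: emb_add emb_mult emb_1 algebra_simps)
  interpret v2: vector_space "(*) :: 'k \<Rightarrow> 'k \<Rightarrow> 'k"
    by unfold_locales (simp_all add: algebra_simps)
  interpret vp: vector_space_pair "\<lambda>c x. emb c * x" "(*) :: 'k \<Rightarrow> 'k \<Rightarrow> 'k" ..
  have "v1.independent {a}" using assms v1.dependent_single by blast
  then obtain \<phi> where "Vector_Spaces.linear (\<lambda>c x. emb c * x) (*) \<phi>" "\<phi> a = 1"
    using vp.linear_independent_extend[of "{a}" "\<lambda>_. 1"] by auto
  then show ?thesis by (intro exI[of _ \<phi>]) (auto simp: Vector_Spaces.linear_iff)
qed

text \<open>
  A relation with coefficients in the larger field holds for each monomial separately. A functional of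
  the larger field, linear over the smaller one and nonzero at a given coefficient, turns it into a
  nontrivial relation over the smaller field.
\<close>

lemma poly_fun_independent:
  assumes P: "finite P" "mpoly.independent P" "P \<subseteq> coord_ring B"
    and zero: "(\<Sum>p\<in>P. fun_scale (a p) (poly_fun p)) = 0" and p: "p \<in> P"
  shows "a p = 0"
proof (rule ccontr)
  assume "a p \<noteq> 0"
  then obtain \<phi> :: "'a \<Rightarrow> 'k" where \<phi>: "\<phi> (a p) \<noteq> 0" "\<And>x y. \<phi> (x + y) = \<phi> x + \<phi> y"
      "\<And>c x. \<phi> (emb c * x) = c * \<phi> x"
    using exists_separating_functional by blast
  define T where "T = (\<Union>p\<in>P. Poly_Mapping.keys p)"
  have T: "finite T" "\<And>t. t \<in> T \<Longrightarrow> Poly_Mapping.keys t \<subseteq> B"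
    using P unfolding T_def coord_ring_def by auto
  define c where "c t = (\<Sum>p\<in>P. emb (Poly_Mapping.lookup p t) * a p)" for t
  have c: "(\<Sum>t\<in>T. c t * monomial t v) = 0" for v
  proof -
    have "0 = (\<Sum>p\<in>P. fun_scale (a p) (poly_fun p)) v" using zero by simp
    also have "\<dots> = (\<Sum>p\<in>P. a p * poly_fun p v)" by (simp add: sum_fun_apply fun_scale_apply)
    also have "\<dots> = (\<Sum>p\<in>P. a p * (\<Sum>t\<in>T. emb (Poly_Mapping.lookup p t) * monomial t v))"
      using T(1) by (intro sum.cong arg_cong2[of _ _ _ _ "(*)"] poly_fun_superset) (auto simp: T_def)
    also have "\<dots> = (\<Sum>t\<in>T. c t * monomial t v)"
      unfolding c_def sum_distrib_left sum_distrib_right by (subst sum.swap) (simp add: mult_ac)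
    finally show ?thesis by simp
  qed
  have coeffs: "(\<Sum>p\<in>P. emb (Poly_Mapping.lookup p t) * a p) = 0" if "t \<in> T" for t
    using monomials_independent[OF T c that] by (simp add: c_def)
  have \<phi>0: "\<phi> 0 = 0" using \<phi>(2)[of 0 0] by (metis add.right_neutral add_left_cancel)
  have \<phi>sum: "\<phi> (sum f A) = (\<Sum>i\<in>A. \<phi> (f i))" for f and A :: "('v, 'k) mpoly set"
    by (induction A rule: infinite_finite_induct) (simp_all add: \<phi>0 \<phi>(2))
  have "(\<Sum>p\<in>P. scale_mpoly (\<phi> (a p)) p) = 0"
  proof (rule poly_mapping_eqI)
    fix t
    have "(\<Sum>p\<in>P. Poly_Mapping.lookup p t * \<phi> (a p)) = 0"
    proof (cases "t \<in> T")
      case True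
      then show ?thesis using arg_cong[OF coeffs[OF True], of \<phi>] by (simp add: \<phi>0 \<phi>sum \<phi>(3))
    next
      case False
      then show ?thesis by (intro sum.neutral) (auto simp: T_def in_keys_iff)
    qed
    then show "Poly_Mapping.lookup (\<Sum>p\<in>P. scale_mpoly (\<phi> (a p)) p) t = Poly_Mapping.lookup 0 t"
      by (simp add: lookup_sum lookup_scale_mpoly mult.commute)
  qed
  then have "\<phi> (a p) = 0"
    using mpoly.independentD[OF P(2,1) order_refl, of "\<lambda>p. \<phi> (a p)" p] p by simp
  then show False using \<phi>(1) by simp
qed

lemma poly_fun_inj_on: "inj_on poly_fun (coord_ring B)"
proof (rule inj_onI)
  fix p q assume pq: "p \<in> coord_ring B" "q \<in> coord_ring B" "poly_fun p = poly_fun q"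
  show "p = q"
  proof (rule ccontr)
    assume "p \<noteq> q"
    have r: "p - q \<in> coord_ring B" using pq mpoly.subspace_diff[OF subspace_coord_ring] by blast
    have "poly_fun (p - q) + poly_fun q = poly_fun p" by (simp add: poly_fun_add[symmetric])
    then have "poly_fun (p - q) = 0" using pq(3) by simp
    then have "(\<Sum>x\<in>{p - q}. fun_scale 1 (poly_fun x)) = 0" by (simp add: fun_space.scale_zero_right)
    then have "(1 :: 'a) = 0"
      using poly_fun_independent[of "{p - q}" "\<lambda>_. 1" "p - q"] \<open>p \<noteq> q\<close> r
        mpoly.dependent_single[of "p - q"] by simp
    then show False by simp
  qed
qed

lemma dim_extension:
  assumes U: "mpoly.subspace U" "mpoly.fin_dim U" "U \<subseteq> coord_ring B"
  shows "fun_space.fin_dim (extension U)" "fun_space.dim (extension U) = mpoly.dim U"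
proof -
  obtain P where P: "finite P" "mpoly.independent P" "mpoly.span P = U" "card P = mpoly.dim U"
    using mpoly.fin_dim_basis[OF U(2,1)] by metis
  have PB: "P \<subseteq> coord_ring B" using P(3) U(3) mpoly.span_superset by blast
  have inj: "inj_on poly_fun P" using poly_fun_inj_on PB inj_on_subset by blast
  have key: "u (poly_fun p) = 0" if "(\<Sum>x\<in>poly_fun ` P. fun_scale (u x) x) = 0" "p \<in> P" for u p
  proof -
    have "(\<Sum>p\<in>P. fun_scale (u (poly_fun p)) (poly_fun p)) = 0"
      using that(1) unfolding sum.reindex[OF inj] comp_def .
    then show ?thesis using poly_fun_independent[OF P(1,2) PB, of "\<lambda>p. u (poly_fun p)" p] that(2) by blast
  qed
  have "fun_space.independent (poly_fun ` P)"
    unfolding fun_space.dependent_finite[OF finite_imageI[OF P(1)]] using key by blast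
  moreover have eq: "extension U = fun_space.span (poly_fun ` P)"
    unfolding P(3)[symmetric] extension_span by (rule extension_def)
  ultimately show "fun_space.dim (extension U) = mpoly.dim U"
    using fun_space.dim_span_eq_card_independent card_image[OF inj] P(4) by metis
  show "fun_space.fin_dim (extension U)"
    unfolding eq using P(1) by (simp add: fun_space.fin_dim_span fun_space.fin_dim_finite)
qed

text \<open>One inclusion is clear, and the dimensions agree as they do for sums.\<close>

lemma extension_Int:
  assumes U: "mpoly.subspace U" "mpoly.fin_dim U" "U \<subseteq> coord_ring B"
    and W: "mpoly.subspace W" "mpoly.fin_dim W" "W \<subseteq> coord_ring B"
  shows "extension (U \<inter> W) = extension U \<inter> extension W"
proof (rule fun_space.fin_dim_dim_equal)
  have I: "mpoly.subspace (U \<inter> W)" "mpoly.fin_dim (U \<inter> W)" "U \<inter> W \<subseteq> coord_ring B"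
    using U(3) mpoly.subspace_inter[OF U(1) W(1)] mpoly.fin_dim_subset[OF Int_lower1 U(2)] by auto
  have S: "mpoly.subspace (mpoly.span (U \<union> W))" "mpoly.fin_dim (mpoly.span (U \<union> W))"
      "mpoly.span (U \<union> W) \<subseteq> coord_ring B"
    using mpoly.fin_dim_span[OF mpoly.fin_dim_Un[OF U(2) W(2)]] U(3) W(3)
      mpoly.span_minimal[OF _ subspace_coord_ring, of "U \<union> W" B] by simp_all
  show "extension (U \<inter> W) \<subseteq> extension U \<inter> extension W"
    using extension_mono[of "U \<inter> W" U] extension_mono[of "U \<inter> W" W] by auto
  show "fun_space.fin_dim (extension U \<inter> extension W)"
    by (rule fun_space.fin_dim_subset[OF Int_lower1 dim_extension(1)[OF U]])
  have "fun_space.dim (fun_space.span (extension U \<union> extension W)) +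
      fun_space.dim (extension U \<inter> extension W) = mpoly.dim U + mpoly.dim W"
    using fun_space.dim_span_Un_Int[OF subspace_extension dim_extension(1)[OF U]
        subspace_extension dim_extension(1)[OF W]] dim_extension(2)[OF U] dim_extension(2)[OF W]
    by simp
  moreover have "mpoly.dim (mpoly.span (U \<union> W)) + mpoly.dim (U \<inter> W) = mpoly.dim U + mpoly.dim W"
    by (rule mpoly.dim_span_Un_Int[OF U(1,2) W(1,2)])
  ultimately show "fun_space.dim (extension U \<inter> extension W) \<le> fun_space.dim (extension (U \<inter> W))"
    using dim_extension(2)[OF I] dim_extension(2)[OF S] unfolding extension_Un by simp
  show "fun_space.subspace (extension U \<inter> extension W)"
    by (intro fun_space.subspace_inter subspace_extension)
qed simp

lemma extension_product: "extension (mpoly.product U W) = fun_space.product (extension U) (extension W)"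
proof
  show "extension (mpoly.product U W) \<subseteq> fun_space.product (extension U) (extension W)"
    unfolding mpoly.product_def extension_span extension_def[of "{x * y |x y. _ x y}"]
    by (rule fun_space.span_minimal)
      (auto simp: poly_fun_mult extension_def intro!: fun_space.productI fun_space.span_base)
  show "fun_space.product (extension U) (extension W) \<subseteq> extension (mpoly.product U W)"
  proof (rule fun_space.product_subset[OF subspace_extension])
    fix x y assume "x \<in> extension U" "y \<in> extension W"
    then have "x * y \<in> fun_space.product (poly_fun ` U) (poly_fun ` W)"
      unfolding extension_def by (rule fun_space.mult_mem_product_of_span)
    moreover have "fun_space.product (poly_fun ` U) (poly_fun ` W) \<subseteq> extension (mpoly.product U W)"
    proof (rule fun_space.product_subset[OF subspace_extension])
      fix x y assume "x \<in> poly_fun ` U" "y \<in> poly_fun ` W"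
      then obtain p q where "x = poly_fun p" "y = poly_fun q" "p \<in> U" "q \<in> W" by blast
      then show "x * y \<in> extension (mpoly.product U W)"
        unfolding extension_def using mpoly.productI[of p U q W]
        by (auto simp: poly_fun_mult[symmetric] intro!: fun_space.span_base)
    qed
    ultimately show "x * y \<in> extension (mpoly.product U W)" by blast
  qed
qed

lemma extension_linear_forms: "extension (mpoly_linear_forms B) = fun_space.span (coordinate ` B)"
proof -
  have "poly_fun ` variable ` B = coordinate ` B" unfolding image_image by (intro image_cong refl poly_fun_variable)
  then show ?thesis unfolding mpoly_linear_forms_def extension_span by (simp add: extension_def)
qed

lemma extension_forms: "extension (src.forms d) = tgt.forms d"
proof (induction d)
  case 0
  show ?case unfolding src.forms.simps tgt.forms.simps extension_span by (simp add: extension_def poly_fun_1)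
next
  case (Suc d)
  then show ?case unfolding src.forms.simps tgt.forms.simps
    by (simp only: extension_product extension_linear_forms)
qed

lemma extension_ideal_forms: "extension (src.ideal_forms M d) = tgt.ideal_forms (extension M) d"
proof (cases d)
  case 0
  have "fun_space.span {0} = {0}"
    using fun_space.span_insert_0[of "{}"] fun_space.span_empty by simp
  then show ?thesis using 0 by (simp only: src.ideal_forms.simps tgt.ideal_forms.simps)
      (simp add: extension_def)
next
  case (Suc d')
  then show ?thesis
    by (simp only: src.ideal_forms.simps tgt.ideal_forms.simps extension_product extension_forms)
qed

lemma forms_subset_coord_ring: "src.forms d \<subseteq> coord_ring B"
proof (induction d)
  case 0
  have "1 \<in> (coord_ring B :: ('v, 'k) mpoly set)" by (auto simp: coord_ring_def)
  then show ?case using mpoly.span_minimal[OF _ subspace_coord_ring, of "{1}" B] by simp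
next
  case (Suc d)
  then show ?case using mpoly_linear_forms_subset unfolding src.forms.simps
    by (intro mpoly.product_subset[OF subspace_coord_ring] coord_ring_mult) auto
qed

lemma dim_intersection_src:
  fixes m :: nat
  assumes "\<And>i. i < m \<Longrightarrow> F i \<subseteq> mpoly_linear_forms B"
  shows "mpoly.dim (src.forms d \<inter> (\<Inter>i<m. src.ideal_forms (F i) d)) =
    fun_space.dim (tgt.forms d \<inter> (\<Inter>i<m. tgt.ideal_forms (extension (F i)) d))"
proof -
  let ?A = "\<lambda>k. src.forms d \<inter> (\<Inter>i<k. src.ideal_forms (F i) d)"
  have A: "mpoly.subspace (?A k)" "mpoly.fin_dim (?A k)" "?A k \<subseteq> coord_ring B" for k
    using forms_subset_coord_ring
    by (auto intro!: mpoly.subspace_inter mpoly.subspace_Inter intro: mpoly.fin_dim_subset[OF _ src.fin_dim_forms])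
  have "extension (?A k) = tgt.forms d \<inter> (\<Inter>i<k. tgt.ideal_forms (extension (F i)) d)" if "k \<le> m" for k
    using that
  proof (induction k)
    case 0
    show ?case using extension_forms by simp
  next
    case (Suc k)
    have sub: "src.ideal_forms (F k) d \<subseteq> src.forms d"
      using src.ideal_forms_subset assms Suc.prems by simp
    have "?A (Suc k) = ?A k \<inter> src.ideal_forms (F k) d" by (auto simp: lessThan_Suc)
    also have "extension \<dots> = extension (?A k) \<inter> extension (src.ideal_forms (F k) d)"
      using sub forms_subset_coord_ring
      by (intro extension_Int A src.subspace_ideal_forms mpoly.fin_dim_subset[OF sub src.fin_dim_forms]) auto
    also have "\<dots> = tgt.forms d \<inter> (\<Inter>i<k. tgt.ideal_forms (extension (F i)) d) \<inter>
        tgt.ideal_forms (extension (F k)) d"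
      using Suc by (simp only: extension_ideal_forms Suc_leD)
    finally show ?case by (auto simp: lessThan_Suc)
  qed
  then show ?thesis using dim_extension(2)[OF A, of m] by simp
qed

end

section \<open>Annihilators of subspaces\<close>

text \<open>
  The linear forms that vanish on \<open>U\<close>. They span the part of degree \<open>1\<close> of the ideal of \<open>U\<close> and generate
  this ideal.
\<close>

definition annihilator_forms ::
    "('k::field \<Rightarrow> 'v::ab_group_add \<Rightarrow> 'v) \<Rightarrow> 'v set \<Rightarrow> 'v set \<Rightarrow> ('v, 'k) mpoly set" where
  "annihilator_forms scale B U =
     {linear_form B f | f. Vector_Spaces.linear scale (*) f \<and> (\<forall>u\<in>U. f u = 0)}"

lemma linear_form_variable: "linear_form B f = (\<Sum>b\<in>B. scale_mpoly (f b) (variable b))"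
  by (simp add: linear_form_def variable_def scale_mpoly_def mult_single)

lemma linear_form_add: "linear_form B (\<lambda>v. f v + g v) = linear_form B f + linear_form B g"
  by (simp add: linear_form_variable mpoly.scale_left_distrib sum.distrib)

lemma linear_form_scale: "linear_form B (\<lambda>v. c * f v) = scale_mpoly c (linear_form B f)"
  by (simp add: linear_form_variable mpoly.scale_sum_right)

lemma linear_form_sum: "linear_form B (\<lambda>v. \<Sum>i\<in>A. f i v) = (\<Sum>i\<in>A. linear_form B (f i))"
proof (induction A rule: infinite_finite_induct)
  case (insert x F)
  then show ?case by (simp add: linear_form_add)
qed (simp_all add: linear_form_variable)

lemma linear_form_in_linear_forms: "linear_form B f \<in> mpoly_linear_forms B"
  unfolding linear_form_variable mpoly_linear_forms_def
  by (intro mpoly.span_sum mpoly.span_scale mpoly.span_base) auto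

lemma single_exponent_inj:
  "Poly_Mapping.single a (Suc 0) = Poly_Mapping.single b (Suc 0) \<Longrightarrow> a = b"
  by (metis keys_single nat.distinct(1) singleton_inject)

lemma lookup_linear_form:
  assumes "finite B" "b \<in> B"
  shows "Poly_Mapping.lookup (linear_form B f) (Poly_Mapping.single b 1) = f b"
proof -
  have "Poly_Mapping.lookup (linear_form B f) (Poly_Mapping.single b 1) =
      (\<Sum>b'\<in>B. if b' = b then f b else 0)"
    unfolding linear_form_def lookup_sum
    by (intro sum.cong refl) (auto simp: lookup_single when_def dest: single_exponent_inj)
  then show ?thesis using assms by simp
qed

context finite_dimensional_vector_space
begin

abbreviation "linear_functional \<equiv> Vector_Spaces.linear scale ((*) :: 'a \<Rightarrow> 'a \<Rightarrow> 'a)"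

lemma vector_space_pair_field: "vector_space_pair scale ((*) :: 'a \<Rightarrow> 'a \<Rightarrow> 'a)"
proof -
  interpret v2: vector_space "(*) :: 'a \<Rightarrow> 'a \<Rightarrow> 'a"
    by unfold_locales (simp_all add: algebra_simps)
  show ?thesis ..
qed

lemma linear_functional_iff:
  "linear_functional f \<longleftrightarrow> (\<forall>x y. f (x + y) = f x + f y) \<and> (\<forall>c x. f (scale c x) = c * f x)"
  using vector_space_pair_field unfolding Vector_Spaces.linear_iff vector_space_pair_def by blast

lemma linear_functional_eqI:
  assumes "linear_functional f" "linear_functional g" "span D = UNIV" "\<And>x. x \<in> D \<Longrightarrow> f x = g x"
  shows "f = g"
proof
  interpret p: vector_space_pair scale "(*) :: 'a \<Rightarrow> 'a \<Rightarrow> 'a" by (rule vector_space_pair_field)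
  fix x show "f x = g x" using p.linear_eq_on[OF assms(1,2), of x D] assms(3,4) by auto
qed

lemma linear_form_eq_0:
  assumes f: "linear_functional f" and "linear_form Basis f = 0"
  shows "f = (\<lambda>_. 0)"
proof (rule linear_functional_eqI[OF f])
  show "linear_functional (\<lambda>_. 0)" by (simp add: linear_functional_iff)
  show "span Basis = UNIV" by (rule span_Basis)
  show "f b = 0" if "b \<in> Basis" for b
    using lookup_linear_form[OF finite_Basis that, of f] assms(2) by simp
qed

lemma subspace_annihilator_forms [simp]: "mpoly.subspace (annihilator_forms scale Basis U)"
proof (rule mpoly.subspaceI)
  show "0 \<in> annihilator_forms scale Basis U"
    unfolding annihilator_forms_def
    by (auto intro!: exI[of _ "\<lambda>_. 0"] simp: linear_functional_iff linear_form_variable)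
next
  fix x y assume "x \<in> annihilator_forms scale Basis U" "y \<in> annihilator_forms scale Basis U"
  then obtain f g where "x = linear_form Basis f" "linear_functional f" "\<forall>u\<in>U. f u = 0"
      "y = linear_form Basis g" "linear_functional g" "\<forall>u\<in>U. g u = 0"
    unfolding annihilator_forms_def by blast
  then show "x + y \<in> annihilator_forms scale Basis U"
    unfolding annihilator_forms_def linear_functional_iff
    by (auto intro!: exI[of _ "\<lambda>v. f v + g v"] simp: linear_form_add algebra_simps)
next
  fix c x assume "x \<in> annihilator_forms scale Basis U"
  then obtain f where "x = linear_form Basis f" "linear_functional f" "\<forall>u\<in>U. f u = 0"
    unfolding annihilator_forms_def by blast
  then show "scale_mpoly c x \<in> annihilator_forms scale Basis U"
    unfolding annihilator_forms_def linear_functional_iff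
    by (auto intro!: exI[of _ "\<lambda>v. c * f v"] simp: linear_form_scale algebra_simps)
qed

lemma annihilator_forms_subset: "annihilator_forms scale Basis U \<subseteq> mpoly_linear_forms Basis"
  unfolding annihilator_forms_def using linear_form_in_linear_forms by auto

lemma annihilator_forms_antimono:
  "U \<subseteq> W \<Longrightarrow> annihilator_forms scale Basis W \<subseteq> annihilator_forms scale Basis U"
  unfolding annihilator_forms_def by blast

lemma fin_dim_mpoly_linear_forms: "mpoly.fin_dim (mpoly_linear_forms Basis)"
  unfolding mpoly_linear_forms_def
  by (simp add: finite_Basis mpoly.fin_dim_span mpoly.fin_dim_finite)

lemma fin_dim_annihilator_forms: "mpoly.fin_dim (annihilator_forms scale Basis U)"
  by (rule mpoly.fin_dim_subset[OF annihilator_forms_subset fin_dim_mpoly_linear_forms])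

text \<open>
  A basis \<open>C\<close> of \<open>U\<close> is extended to a basis \<open>D\<close> of the space. The members of the dual basis that belong to
  \<open>D - C\<close> form a basis of the annihilator.
\<close>

lemma dim_annihilator_forms:
  assumes U: "subspace U"
  shows "mpoly.dim (annihilator_forms scale Basis U) = codim scale U"
proof -
  interpret p: vector_space_pair scale "(*) :: 'a \<Rightarrow> 'a \<Rightarrow> 'a" by (rule vector_space_pair_field)
  obtain C where C: "C \<subseteq> U" "independent C" "U \<subseteq> span C" "card C = dim U"
    using basis_exists[of U] by metis
  obtain D where D: "C \<subseteq> D" "independent D" "UNIV \<subseteq> span D"
    using maximal_independent_subset_extend[OF subset_UNIV C(2)] by metis
  have finD: "finite D" using D(2) finiteI_independent by blast
  have spanD: "span D = UNIV" using D(3) by blast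
  have cardD: "card D = dim UNIV" using basis_card_eq_dim[OF subset_UNIV D(3,2)] .
  obtain \<delta> where \<delta>: "linear_functional (\<delta> c)" "\<And>x. x \<in> D \<Longrightarrow> \<delta> c x = (if x = c then 1 else 0)" for c
  proof -
    have "\<exists>g. linear_functional g \<and> (\<forall>x\<in>D. g x = (if x = c then 1 else 0))" for c
      using p.linear_independent_extend[OF D(2), of "\<lambda>x. if x = c then 1 else 0"] .
    then show ?thesis using that by metis
  qed
  let ?E = "D - C" and ?h = "\<lambda>c. linear_form Basis (\<delta> c)"
  have sum_lin: "linear_functional (\<lambda>v. \<Sum>c\<in>?E. u c * \<delta> c v)" for u
  proof -
    have add: "\<delta> c (x + y) = \<delta> c x + \<delta> c y" and sc: "\<delta> c (scale a x) = a * \<delta> c x" for a c x y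
      using \<delta>(1)[of c] unfolding linear_functional_iff by auto
    show ?thesis
      unfolding linear_functional_iff
    proof (intro conjI allI)
      show "(\<Sum>c\<in>?E. u c * \<delta> c (x + y)) = (\<Sum>c\<in>?E. u c * \<delta> c x) + (\<Sum>c\<in>?E. u c * \<delta> c y)" for x y
        by (simp only: add distrib_left sum.distrib)
      show "(\<Sum>c\<in>?E. u c * \<delta> c (scale a x)) = a * (\<Sum>c\<in>?E. u c * \<delta> c x)" for a x
        unfolding sum_distrib_left sc by (intro sum.cong refl mult.left_commute)
    qed
  qed
  have sum_at: "(\<Sum>c\<in>?E. u c * \<delta> c x) = (if x \<in> ?E then u x else 0)" if "x \<in> D" for u x
  proof -
    have "(\<Sum>c\<in>?E. u c * \<delta> c x) = (\<Sum>c\<in>?E. if x = c then u x else 0)"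
      using \<delta>(2)[OF that] by (intro sum.cong) auto
    then show ?thesis using finD by simp
  qed
  have lf_sum: "linear_form Basis (\<lambda>v. \<Sum>c\<in>?E. u c * \<delta> c v) = (\<Sum>c\<in>?E. scale_mpoly (u c) (?h c))" for u
    by (simp only: linear_form_sum linear_form_scale)
  have zero: "u c = 0" if "(\<Sum>c\<in>?E. scale_mpoly (u c) (?h c)) = 0" "c \<in> ?E" for u c
  proof -
    have "(\<lambda>v. \<Sum>c\<in>?E. u c * \<delta> c v) = (\<lambda>_. 0)"
      by (rule linear_form_eq_0[OF sum_lin]) (simp only: lf_sum that(1))
    from fun_cong[OF this, of c] show ?thesis using sum_at[of c u] that(2) by simp
  qed
  have inj: "inj_on ?h ?E"
  proof (rule inj_onI, rule ccontr)
    fix a b assume ab: "a \<in> ?E" "b \<in> ?E" "?h a = ?h b" "a \<noteq> b"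
    define u where "u c = (if c = a then 1 else if c = b then -1 else 0 :: 'a)" for c
    have "(\<Sum>c\<in>?E. scale_mpoly (u c) (?h c)) = (\<Sum>c\<in>{a, b}. scale_mpoly (u c) (?h c))"
      using ab finD by (intro sum.mono_neutral_right) (auto simp: u_def)
    also have "\<dots> = 0" using ab(3,4) by (simp add: u_def)
    finally have "u a = 0" using zero ab(1) by blast
    then show False by (simp add: u_def)
  qed
  have "mpoly.independent (?h ` ?E)"
  proof -
    have "u (?h c) = 0" if "(\<Sum>x\<in>?h ` ?E. scale_mpoly (u x) x) = 0" "c \<in> ?E" for u c
      using zero[of "\<lambda>c. u (?h c)" c] that unfolding sum.reindex[OF inj] comp_def by blast
    then show ?thesis using finD by (subst mpoly.dependent_finite) auto
  qed
  moreover have "?h ` ?E \<subseteq> annihilator_forms scale Basis U"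
  proof
    fix x assume "x \<in> ?h ` ?E"
    then obtain c where c: "c \<in> ?E" "x = ?h c" by blast
    have "\<delta> c u = 0" if "u \<in> span C" for u
    proof (rule p.linear_eq_0_on_span[OF \<delta>(1) _ that])
      fix x assume "x \<in> C"
      then have "x \<in> D" "x \<noteq> c" using D(1) c(1) by auto
      then show "\<delta> c x = 0" using \<delta>(2) by simp
    qed
    then show "x \<in> annihilator_forms scale Basis U"
      unfolding annihilator_forms_def using c(2) \<delta>(1) C(3) by blast
  qed
  moreover have "annihilator_forms scale Basis U \<subseteq> mpoly.span (?h ` ?E)"
  proof
    fix x assume "x \<in> annihilator_forms scale Basis U"
    then obtain f where f: "x = linear_form Basis f" "linear_functional f" "\<forall>u\<in>U. f u = 0"
      unfolding annihilator_forms_def by blast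
    have "f = (\<lambda>v. \<Sum>c\<in>?E. f c * \<delta> c v)"
    proof (rule linear_functional_eqI[OF f(2) sum_lin spanD])
      fix y assume "y \<in> D"
      then show "f y = (\<Sum>c\<in>?E. f c * \<delta> c y)" using sum_at[of y f] f(3) C(1) by auto
    qed
    then have "x = (\<Sum>c\<in>?E. scale_mpoly (f c) (?h c))" using f(1) lf_sum[of f] by simp
    then show "x \<in> mpoly.span (?h ` ?E)"
      by (auto intro!: mpoly.span_sum mpoly.span_scale intro: mpoly.span_base)
  qed
  ultimately have "mpoly.dim (annihilator_forms scale Basis U) = card (?h ` ?E)"
    using mpoly.basis_card_eq_dim by metis
  also have "\<dots> = card D - card C"
    using inj D(1) finite_subset[OF D(1) finD] by (simp add: card_image card_Diff_subset)
  finally show ?thesis using cardD C(4) by (simp add: codim_def)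
qed

text \<open>Both sides have the same dimension by duality, and one inclusion is clear.\<close>

lemma annihilator_forms_Int:
  assumes U: "subspace U" and W: "subspace W"
  shows "annihilator_forms scale Basis (U \<inter> W) =
    mpoly.span (annihilator_forms scale Basis U \<union> annihilator_forms scale Basis W)"
    (is "?A (U \<inter> W) = mpoly.span (?A U \<union> ?A W)")
proof -
  let ?s = "{x + y |x y. x \<in> U \<and> y \<in> W}"
  have s: "subspace ?s" using U W by (rule subspace_sums)
  have int: "?A U \<inter> ?A W = ?A ?s"
  proof
    show "?A U \<inter> ?A W \<subseteq> ?A ?s"
    proof
      fix x assume "x \<in> ?A U \<inter> ?A W"
      then obtain f g where f: "x = linear_form Basis f" "linear_functional f" "\<forall>u\<in>U. f u = 0"
        and g: "x = linear_form Basis g" "linear_functional g" "\<forall>u\<in>W. g u = 0"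
        unfolding annihilator_forms_def by blast
      have "f = g"
      proof (rule linear_functional_eqI[OF f(2) g(2) span_Basis])
        show "f b = g b" if "b \<in> Basis" for b
          using lookup_linear_form[OF finite_Basis that, of f]
            lookup_linear_form[OF finite_Basis that, of g] f(1) g(1) by simp
      qed
      then have "\<forall>u\<in>?s. f u = 0" using f(2,3) g(3) by (auto simp: linear_functional_iff)
      then show "x \<in> ?A ?s" unfolding annihilator_forms_def using f by blast
    qed
    have "x + 0 \<in> ?s" if "x \<in> U" for x
      using that subspace_0[OF W] by blast
    moreover have "0 + x \<in> ?s" if "x \<in> W" for x
      using that subspace_0[OF U] by blast
    ultimately show "?A ?s \<subseteq> ?A U \<inter> ?A W"
      using annihilator_forms_antimono[of U ?s] annihilator_forms_antimono[of W ?s]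
      by (simp add: subset_iff)
  qed
  have "mpoly.dim (mpoly.span (?A U \<union> ?A W)) + mpoly.dim (?A ?s) = mpoly.dim (?A U) + mpoly.dim (?A W)"
    unfolding int[symmetric]
    by (intro mpoly.dim_span_Un_Int subspace_annihilator_forms fin_dim_annihilator_forms)
  moreover have "dim ?s + dim (U \<inter> W) = dim U + dim W"
    using dim_sums_Int[OF U W] by simp
  moreover have "dim U \<le> dim UNIV" "dim W \<le> dim UNIV" "dim ?s \<le> dim UNIV" "dim (U \<inter> W) \<le> dim UNIV"
    by (intro dim_subset subset_UNIV)+
  ultimately have "mpoly.dim (?A (U \<inter> W)) = mpoly.dim (mpoly.span (?A U \<union> ?A W))"
    using dim_annihilator_forms[OF U] dim_annihilator_forms[OF W] dim_annihilator_forms[OF s]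
      dim_annihilator_forms[OF subspace_inter[OF U W]] unfolding codim_def by linarith
  then have "mpoly.dim (?A (U \<inter> W)) \<le> mpoly.dim (mpoly.span (?A U \<union> ?A W))" by simp
  moreover have "?A U \<union> ?A W \<subseteq> ?A (U \<inter> W)"
    using annihilator_forms_antimono[OF Int_lower1] annihilator_forms_antimono[OF Int_lower2] by blast
  then have "mpoly.span (?A U \<union> ?A W) \<subseteq> ?A (U \<inter> W)"
    by (rule mpoly.span_minimal[OF _ subspace_annihilator_forms])
  ultimately show ?thesis
    using mpoly.fin_dim_dim_equal[OF _ fin_dim_annihilator_forms mpoly.subspace_span
        subspace_annihilator_forms] by metis
qed

lemma annihilator_forms_UNIV: "annihilator_forms scale Basis UNIV = {0}"
  unfolding annihilator_forms_def
  by (auto intro!: exI[of _ "\<lambda>_. 0"] simp: linear_functional_iff linear_form_variable)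

lemma annihilator_forms_INT:
  assumes "finite S" "\<And>i. i \<in> S \<Longrightarrow> subspace (V i)"
  shows "annihilator_forms scale Basis (\<Inter>i\<in>S. V i) =
    mpoly.span (\<Union>i\<in>S. annihilator_forms scale Basis (V i))"
  using assms
proof (induction S)
  case empty
  then show ?case by (simp add: annihilator_forms_UNIV)
next
  case (insert x F)
  have "subspace (V x)" "subspace (\<Inter>i\<in>F. V i)" using insert by (auto intro: subspace_Inter)
  then have "annihilator_forms scale Basis (\<Inter>i\<in>insert x F. V i) =
      mpoly.span (annihilator_forms scale Basis (V x) \<union>
        mpoly.span (\<Union>i\<in>F. annihilator_forms scale Basis (V i)))"
    using insert annihilator_forms_Int[of "V x" "\<Inter>i\<in>F. V i"] by simp
  also have "\<dots> = mpoly.span (\<Union>i\<in>insert x F. annihilator_forms scale Basis (V i))"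
    by (simp add: mpoly.span_Un mpoly.span_span)
  finally show ?case .
qed

lemma dim_mpoly_linear_forms: "mpoly.dim (mpoly_linear_forms Basis :: ('b, 'a) mpoly set) = dim UNIV"
proof (rule antisym)
  let ?X = "variable ` Basis :: ('b, 'a) mpoly set"
  have "mpoly.dim (mpoly_linear_forms Basis :: ('b, 'a) mpoly set) \<le> card ?X"
    unfolding mpoly_linear_forms_def
    by (rule mpoly.dim_le_card[OF order_refl finite_imageI[OF finite_Basis]])
  also have "\<dots> \<le> card Basis" using finite_Basis by (rule card_image_le)
  finally show "mpoly.dim (mpoly_linear_forms Basis :: ('b, 'a) mpoly set) \<le> dim UNIV" by simp
  have "dim UNIV = mpoly.dim (annihilator_forms scale Basis {0})"
    using dim_annihilator_forms[of "{0}"] by (simp add: codim_def subspace_single_0)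
  also have "\<dots> \<le> mpoly.dim (mpoly_linear_forms Basis :: ('b, 'a) mpoly set)"
    by (rule mpoly.fin_dim_dim_mono[OF annihilator_forms_subset fin_dim_mpoly_linear_forms])
  finally show "dim UNIV \<le> mpoly.dim (mpoly_linear_forms Basis :: ('b, 'a) mpoly set)" .
qed

end

section \<open>The Hilbert function of a transversal arrangement\<close>

lemma total_degree_superset:
  assumes "finite X" "Poly_Mapping.keys t \<subseteq> X"
  shows "total_degree t = (\<Sum>x\<in>X. Poly_Mapping.lookup t x)"
  unfolding total_degree_def using assms by (intro sum.mono_neutral_left) (auto simp: in_keys_iff)

lemma total_degree_add: "total_degree (s + t) = total_degree s + total_degree t"
proof -
  let ?X = "Poly_Mapping.keys s \<union> Poly_Mapping.keys t"
  have "total_degree (s + t) = (\<Sum>x\<in>?X. Poly_Mapping.lookup (s + t) x)"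
    using Poly_Mapping.keys_add[of s t] by (intro total_degree_superset) auto
  also have "\<dots> = total_degree s + total_degree t"
    by (simp add: total_degree_superset[of ?X] lookup_add sum.distrib)
  finally show ?thesis .
qed

lemma total_degree_single: "total_degree (Poly_Mapping.single b e) = e"
  by (simp add: total_degree_def)

definition homogeneous_component :: "nat \<Rightarrow> ('v, 'k::field) mpoly \<Rightarrow> ('v, 'k) mpoly" where
  "homogeneous_component d p = Poly_Mapping.mapp (\<lambda>t c. c when total_degree t = d) p"

lemma lookup_homogeneous_component:
  "Poly_Mapping.lookup (homogeneous_component d p) t = (Poly_Mapping.lookup p t when total_degree t = d)"
  by (auto simp: homogeneous_component_def lookup_mapp when_def in_keys_iff)

lemma homogeneous_component_add: "homogeneous_component d (p + q) = homogeneous_component d p + homogeneous_component d q"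
  by (rule poly_mapping_eqI) (simp add: lookup_homogeneous_component lookup_add when_add_distrib)

lemma homogeneous_component_0 [simp]: "homogeneous_component d 0 = 0"
  by (rule poly_mapping_eqI) (simp add: lookup_homogeneous_component)

lemma homogeneous_component_sum: "homogeneous_component d (sum f A) = (\<Sum>i\<in>A. homogeneous_component d (f i))"
  by (induction A rule: infinite_finite_induct) (simp_all add: homogeneous_component_add)

lemma homogeneous_component_single:
  "homogeneous_component d (Poly_Mapping.single t c) = (Poly_Mapping.single t c when total_degree t = d)"
  by (rule poly_mapping_eqI) (auto simp: lookup_homogeneous_component lookup_single when_def)

lemma homogeneous_component_id:
  assumes "\<forall>t\<in>Poly_Mapping.keys p. total_degree t = d"
  shows "homogeneous_component d p = p"
  by (rule poly_mapping_eqI) (use assms in \<open>auto simp: lookup_homogeneous_component when_def in_keys_iff\<close>)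

lemma keys_homogeneous_component: "t \<in> Poly_Mapping.keys (homogeneous_component d p) \<longleftrightarrow> t \<in> Poly_Mapping.keys p \<and> total_degree t = d"
  by (simp add: in_keys_iff lookup_homogeneous_component when_def)

lemma homogeneous_component_in_homogeneous_part:
  "p \<in> coord_ring B \<Longrightarrow> homogeneous_component d p \<in> homogeneous_part (coord_ring B) d"
  unfolding homogeneous_part_def coord_ring_def by (auto simp: keys_homogeneous_component)

lemma homogeneous_component_mult_linear:
  assumes "\<forall>t\<in>Poly_Mapping.keys l. total_degree t = 1"
  shows "homogeneous_component (Suc d) (a * l) = homogeneous_component d a * l" "homogeneous_component 0 (a * l) = 0"
proof -
  let ?s = "\<lambda>p t. Poly_Mapping.single t (Poly_Mapping.lookup p t)"
  let ?A = "Poly_Mapping.keys a" and ?L = "Poly_Mapping.keys l"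
  have al: "homogeneous_component e (a * l) = (\<Sum>s\<in>?A. \<Sum>t\<in>?L. homogeneous_component e (?s a s * ?s l t))" for e
  proof -
    have "a * l = (\<Sum>s\<in>?A. \<Sum>t\<in>?L. ?s a s * ?s l t)"
      by (subst mpoly_expansion[of a], subst mpoly_expansion[of l], rule sum_product)
    then show ?thesis by (simp only: homogeneous_component_sum)
  qed
  have deg: "total_degree (s + t) = Suc (total_degree s)" if "t \<in> ?L" for s t
    using assms that by (simp add: total_degree_add)
  have "homogeneous_component (Suc d) (a * l) = (\<Sum>s\<in>?A. \<Sum>t\<in>?L. homogeneous_component d (?s a s) * ?s l t)"
    unfolding al by (intro sum.cong refl) (auto simp: mult_single homogeneous_component_single deg when_def)
  also have "\<dots> = homogeneous_component d (\<Sum>s\<in>?A. ?s a s) * (\<Sum>t\<in>?L. ?s l t)"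
    by (simp only: homogeneous_component_sum sum_product)
  also have "\<dots> = homogeneous_component d a * l" by (simp only: mpoly_expansion[symmetric])
  finally show "homogeneous_component (Suc d) (a * l) = homogeneous_component d a * l" .
  show "homogeneous_component 0 (a * l) = 0"
    unfolding al by (intro sum.neutral ballI) (auto simp: mult_single homogeneous_component_single deg when_def)
qed

lemma subspace_ideal_generated:
  assumes R: "0 \<in> R" "\<And>x y. x \<in> R \<Longrightarrow> y \<in> R \<Longrightarrow> x + y \<in> R"
    "\<And>c x. x \<in> R \<Longrightarrow> scale_mpoly c x \<in> R"
  shows "mpoly.subspace (ideal_generated R S)"
proof (rule mpoly.subspaceI)
  show "0 \<in> ideal_generated R S"
    unfolding ideal_generated_def by (auto intro!: exI[of _ "{}"])
next
  fix x y assume "x \<in> ideal_generated R S" "y \<in> ideal_generated R S"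
  then obtain a A b B where x: "x = (\<Sum>l\<in>A. a l * l)" "finite A" "A \<subseteq> S" "\<forall>l\<in>A. a l \<in> R"
    and y: "y = (\<Sum>l\<in>B. b l * l)" "finite B" "B \<subseteq> S" "\<forall>l\<in>B. b l \<in> R"
    unfolding ideal_generated_def by blast
  define c where "c l = (if l \<in> A then a l else 0) + (if l \<in> B then b l else 0)" for l
  have "(\<Sum>l\<in>A \<union> B. (if l \<in> A then a l else 0) * l) = x"
    unfolding x(1) using x(2) y(2) by (intro sum.mono_neutral_cong_right) auto
  moreover have "(\<Sum>l\<in>A \<union> B. (if l \<in> B then b l else 0) * l) = y"
    unfolding y(1) using x(2) y(2) by (intro sum.mono_neutral_cong_right) auto
  ultimately have "x + y = (\<Sum>l\<in>A \<union> B. c l * l)"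
    by (simp only: c_def distrib_right sum.distrib)
  moreover have "\<forall>l\<in>A \<union> B. c l \<in> R" using x(4) y(4) R by (auto simp: c_def)
  ultimately show "x + y \<in> ideal_generated R S"
    unfolding ideal_generated_def using x(2,3) y(2,3) by blast
next
  fix k x assume "x \<in> ideal_generated R S"
  then obtain a A where x: "x = (\<Sum>l\<in>A. a l * l)" "finite A" "A \<subseteq> S" "\<forall>l\<in>A. a l \<in> R"
    unfolding ideal_generated_def by blast
  define b where "b l = scale_mpoly k (a l)" for l
  have "scale_mpoly k x = (\<Sum>l\<in>A. b l * l)"
    unfolding x(1) b_def mpoly.scale_sum_right mpoly.scale_mult_left ..
  moreover have "\<forall>l\<in>A. b l \<in> R" using x(4) R(3) by (simp add: b_def)
  ultimately show "scale_mpoly k x \<in> ideal_generated R S"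
    unfolding ideal_generated_def using x(2,3) by blast
qed

context scalar_extension
begin

lemma subspace_homogeneous_part:
  fixes I :: "('v, 'k) mpoly set"
  assumes I: "mpoly.subspace I"
  shows "mpoly.subspace (homogeneous_part I d)"
proof (rule mpoly.subspaceI)
  show "0 \<in> homogeneous_part I d" using mpoly.subspace_0[OF I] by (simp add: homogeneous_part_def)
  show "x + y \<in> homogeneous_part I d" if "x \<in> homogeneous_part I d" "y \<in> homogeneous_part I d" for x y
    using that Poly_Mapping.keys_add[of x y] mpoly.subspace_add[OF I]
    unfolding homogeneous_part_def by blast
  show "scale_mpoly c x \<in> homogeneous_part I d" if "x \<in> homogeneous_part I d" for c x
    using that mpoly.subspace_scale[OF I]
    unfolding homogeneous_part_def by (auto simp: in_keys_iff lookup_scale_mpoly)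
qed

lemma linear_form_degree:
  fixes l :: "('v, 'k) mpoly"
  assumes "l \<in> mpoly_linear_forms B"
  shows "l \<in> homogeneous_part (coord_ring B) 1"
proof -
  have "variable ` B \<subseteq> (homogeneous_part (coord_ring B) 1 :: ('v, 'k) mpoly set)"
    by (auto simp: homogeneous_part_def coord_ring_def variable_def total_degree_single)
  then show ?thesis
    using assms mpoly.span_minimal[OF _ subspace_homogeneous_part[OF subspace_coord_ring]]
    unfolding mpoly_linear_forms_def by blast
qed

lemma single_in_forms:
  assumes "Poly_Mapping.keys t \<subseteq> B" "total_degree t = d"
  shows "Poly_Mapping.single t c \<in> src.forms d"
  using assms
proof (induction d arbitrary: t)
  case 0
  have "t = 0"
    by (rule poly_mapping_eqI) (use 0 in \<open>auto simp: total_degree_def in_keys_iff\<close>)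
  then have "Poly_Mapping.single t c = scale_mpoly c 1" by (simp add: scale_mpoly_def)
  then show ?case unfolding src.forms.simps
    using mpoly.span_scale[OF mpoly.span_base, of 1 "{1}" c] by simp
next
  case (Suc d)
  then have "Poly_Mapping.keys t \<noteq> {}" by (auto simp: total_degree_def)
  then obtain b where b: "b \<in> Poly_Mapping.keys t" by blast
  define t' where "t' = t - Poly_Mapping.single b 1"
  have t: "t = Poly_Mapping.single b 1 + t'"
  proof (rule poly_mapping_eqI)
    fix x show "Poly_Mapping.lookup t x = Poly_Mapping.lookup (Poly_Mapping.single b 1 + t') x"
      using b by (auto simp: t'_def lookup_add lookup_minus lookup_single when_def in_keys_iff)
  qed
  have "Poly_Mapping.keys t' \<subseteq> Poly_Mapping.keys t"
    by (auto simp: t'_def in_keys_iff lookup_minus)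
  moreover have "total_degree t' = d"
    using Suc.prems(2) arg_cong[OF t, of total_degree] by (simp add: total_degree_add total_degree_single)
  ultimately have "Poly_Mapping.single t' c \<in> src.forms d" using Suc.IH Suc.prems(1) by blast
  moreover have "variable b \<in> (mpoly_linear_forms B :: ('v, 'k) mpoly set)"
    using b Suc.prems(1) unfolding mpoly_linear_forms_def by (auto intro: mpoly.span_base)
  ultimately have "variable b * Poly_Mapping.single t' c \<in> src.forms (Suc d)"
    by (simp add: mpoly.productI)
  then show ?case by (subst t) (simp add: variable_def mult_single)
qed

lemma homogeneous_part_coord_ring:
  "homogeneous_part (coord_ring B :: ('v, 'k) mpoly set) d = src.forms d"
proof
  show "homogeneous_part (coord_ring B :: ('v, 'k) mpoly set) d \<subseteq> src.forms d"
  proof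
    fix p :: "('v, 'k) mpoly" assume p: "p \<in> homogeneous_part (coord_ring B) d"
    have "(\<Sum>t\<in>Poly_Mapping.keys p. Poly_Mapping.single t (Poly_Mapping.lookup p t)) \<in> src.forms d"
      using p by (intro mpoly.subspace_sum[OF src.subspace_forms] single_in_forms)
        (auto simp: homogeneous_part_def coord_ring_def)
    then show "p \<in> src.forms d" by (simp only: mpoly_expansion[symmetric])
  qed
  show "src.forms d \<subseteq> homogeneous_part (coord_ring B :: ('v, 'k) mpoly set) d"
  proof (induction d)
    case 0
    have "1 \<in> (homogeneous_part (coord_ring B) 0 :: ('v, 'k) mpoly set)"
      by (auto simp: homogeneous_part_def coord_ring_def total_degree_def)
    then show ?case unfolding src.forms.simps
      by (intro mpoly.span_minimal subspace_homogeneous_part subspace_coord_ring) auto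
  next
    case (Suc d)
    show ?case unfolding src.forms.simps
    proof (rule mpoly.product_subset[OF subspace_homogeneous_part[OF subspace_coord_ring]])
      fix x y :: "('v, 'k) mpoly" assume "x \<in> mpoly_linear_forms B" "y \<in> src.forms d"
      then have xy: "x \<in> homogeneous_part (coord_ring B) 1" "y \<in> homogeneous_part (coord_ring B) d"
        using linear_form_degree Suc.IH by auto
      then have "x * y \<in> coord_ring B" unfolding homogeneous_part_def using coord_ring_mult by blast
      moreover have "total_degree t = Suc d" if "t \<in> Poly_Mapping.keys (x * y)" for t
        using keys_mult[of x y] that xy by (auto simp: homogeneous_part_def total_degree_add)
      ultimately show "x * y \<in> homogeneous_part (coord_ring B) (Suc d)"
        unfolding homogeneous_part_def by blast
    qed
  qed
qed

text \<open>
  In a representation of a homogeneous element of degree \<open>d\<close> by linear generators, the coefficients may be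
  replaced by their components of degree \<open>d - 1\<close>.
\<close>

lemma homogeneous_part_ideal_generated:
  assumes M: "M \<subseteq> (mpoly_linear_forms B :: ('v, 'k) mpoly set)"
  shows "homogeneous_part (ideal_generated (coord_ring B) M) d = src.ideal_forms M d"
proof
  let ?J = "ideal_generated (coord_ring B) M"
  have J: "mpoly.subspace ?J"
    using mpoly.subspace_0[OF subspace_coord_ring] mpoly.subspace_add[OF subspace_coord_ring]
      mpoly.subspace_scale[OF subspace_coord_ring]
    by (intro subspace_ideal_generated) blast+
  show "homogeneous_part ?J d \<subseteq> src.ideal_forms M d"
  proof
    fix p assume p: "p \<in> homogeneous_part ?J d"
    then obtain a A where a: "p = (\<Sum>l\<in>A. a l * l)" "finite A" "A \<subseteq> M" "\<forall>l\<in>A. a l \<in> coord_ring B"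
      unfolding homogeneous_part_def ideal_generated_def by blast
    have pd: "p = (\<Sum>l\<in>A. homogeneous_component d (a l * l))"
      using homogeneous_component_id[of p d] p a(1) unfolding homogeneous_part_def
      by (simp add: homogeneous_component_sum)
    have deg: "\<forall>t\<in>Poly_Mapping.keys l. total_degree t = 1" if "l \<in> A" for l
      using linear_form_degree[of l] that a(3) M unfolding homogeneous_part_def by blast
    show "p \<in> src.ideal_forms M d"
    proof (cases d)
      case 0
      then have "p = 0" using pd homogeneous_component_mult_linear(2)[OF deg] by simp
      then show ?thesis using 0 by simp
    next
      case (Suc d')
      have "homogeneous_component d (a l * l) \<in> src.ideal_forms M d" if "l \<in> A" for l
      proof -
        have "homogeneous_component d' (a l) \<in> src.forms d'"
          using homogeneous_component_in_homogeneous_part a(4) that homogeneous_part_coord_ring by blast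
        then have "l * homogeneous_component d' (a l) \<in> mpoly.product M (src.forms d')"
          using that a(3) by (intro mpoly.productI) auto
        then show ?thesis using homogeneous_component_mult_linear(1)[OF deg[OF that], of d' "a l"] Suc
          by (simp add: mult.commute)
      qed
      then show ?thesis by (subst pd) (intro mpoly.subspace_sum src.subspace_ideal_forms)
    qed
  qed
  show "src.ideal_forms M d \<subseteq> homogeneous_part ?J d"
  proof (cases d)
    case 0
    then show ?thesis using mpoly.subspace_0[OF J] by (simp add: homogeneous_part_def)
  next
    case (Suc d')
    have "mpoly.product M (src.forms d') \<subseteq> homogeneous_part ?J d"
    proof (rule mpoly.product_subset[OF subspace_homogeneous_part[OF J]])
      fix x y assume xy: "x \<in> M" "y \<in> src.forms d'"
      then have "y \<in> coord_ring B" using forms_subset_coord_ring by blast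
      then have "x * y \<in> ?J"
        unfolding ideal_generated_def using xy(1)
        by (auto intro!: exI[of _ "{x}"] exI[of _ "\<lambda>_. y"] simp: mult.commute)
      moreover have "x * y \<in> src.forms d"
        using xy M Suc by (auto intro: mpoly.productI)
      ultimately show "x * y \<in> homogeneous_part ?J d"
        using homogeneous_part_coord_ring[of d] by (auto simp: homogeneous_part_def)
    qed
    then show ?thesis using Suc by simp
  qed
qed

lemma extension_UN: "extension (\<Union>i\<in>S. X i) = fun_space.span ({0} \<union> (\<Union>i\<in>S. extension (X i)))"
proof
  show "extension (\<Union>i\<in>S. X i) \<subseteq> fun_space.span ({0} \<union> (\<Union>i\<in>S. extension (X i)))"
    unfolding extension_def by (intro fun_space.span_mono) (auto intro: fun_space.span_base)
  show "fun_space.span ({0} \<union> (\<Union>i\<in>S. extension (X i))) \<subseteq> extension (\<Union>i\<in>S. X i)"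
    using extension_mono[of "X _" "\<Union>i\<in>S. X i"] fun_space.subspace_0[OF subspace_extension]
    by (intro fun_space.span_minimal subspace_extension) blast
qed

end

lemma infinite_poly_fract: "infinite (UNIV :: 'k::field poly fract set)"
proof -
  have "inj (\<lambda>i. to_fract (monom 1 i) :: 'k poly fract)"
    by (rule injI) (simp add: monom_eq_iff')
  then show ?thesis using finite_imageD infinite_UNIV_nat by (metis finite_subset subset_UNIV)
qed

text \<open>
  The homogeneous parts of the ideal are moved, without changing their dimensions, to polynomial
  functions over \<open>K(t)\<close>, where the dimension formula for transversal intersections holds. The condition
  on \<open>d\<close> and \<open>n\<close> concerns \<open>m = n = 0\<close>: then the ideal is the field itself, which has dimension \<open>1\<close> in
  degree \<open>0\<close>, while the functional is zero.
\<close>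

theorem hilbert_function_arrangement_ideal:
  fixes scale :: "'k::field \<Rightarrow> 'v::ab_group_add \<Rightarrow> 'v"
  assumes "finite_dimensional_vector_space scale B"
    and n: "vector_space.dim scale UNIV = n"
    and V: "\<forall>j<m. module.subspace scale (V j)"
    and tr: "transversal scale m V"
    and d: "m \<le> d" "0 < d \<or> 0 < n"
  shows "int (hilbert_function (arrangement_ideal scale B m V) d) =
    hilbert_functional n d (\<Prod>i<m. 1 - monom 1 (codim scale (V i)))"
proof -
  interpret finite_dimensional_vector_space scale B by fact
  interpret e: scalar_extension "\<lambda>c :: 'k. to_fract [:c:]" B
    by unfold_locales (simp_all add: finite_Basis infinite_poly_fract flip: to_fract_add to_fract_mult one_pCons)
  let ?A = "\<lambda>i. annihilator_forms scale B (V i)"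
  have "homogeneous_part (arrangement_ideal scale B m V) d =
      homogeneous_part (coord_ring B) d \<inter> (\<Inter>i<m. homogeneous_part (subspace_ideal scale B (V i)) d)"
    by (auto simp: homogeneous_part_def arrangement_ideal_def)
  also have "\<dots> = e.src.forms d \<inter> (\<Inter>i<m. e.src.ideal_forms (?A i) d)"
    unfolding subspace_ideal_def annihilator_forms_def[symmetric]
    by (simp only: e.homogeneous_part_coord_ring
        e.homogeneous_part_ideal_generated[OF annihilator_forms_subset])
  finally have hom: "hilbert_function (arrangement_ideal scale B m V) d =
      fun_space.dim (e.tgt.forms d \<inter> (\<Inter>i<m. e.tgt.ideal_forms (e.extension (?A i)) d))"
    unfolding hilbert_function_def
    using e.dim_intersection_src[of m ?A d, OF annihilator_forms_subset] by simp
  let ?L = "fun_space.span (coordinate ` B :: (('v \<Rightarrow> 'k poly fract) \<Rightarrow> 'k poly fract) set)"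
  let ?zero = "{0 :: ('v \<Rightarrow> 'k poly fract) \<Rightarrow> 'k poly fract}"
  have dimL: "fun_space.dim ?L = n"
    using e.dim_extension(2)[OF _ fin_dim_mpoly_linear_forms mpoly_linear_forms_subset]
      dim_mpoly_linear_forms n unfolding e.extension_linear_forms
    by (simp add: mpoly_linear_forms_def)
  have "e.tgt.rel_transversal ?zero (\<lambda>i. e.extension (?A i)) (\<lambda>i. codim scale (V i)) m"
    unfolding e.tgt.rel_transversal_def
  proof (intro conjI allI impI)
    show "fun_space.subspace ?zero" by (rule fun_space.subspace_single_0)
    show "?zero \<subseteq> ?L" by (simp add: fun_space.span_zero)
    show "fun_space.subspace (e.extension (?A i))" for i by simp
    show "?zero \<subseteq> e.extension (?A i)" for i
      using fun_space.subspace_0[OF e.subspace_extension] by simp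
    show "e.extension (?A i) \<subseteq> ?L" for i
      using e.extension_mono[OF annihilator_forms_subset] unfolding e.extension_linear_forms .
    fix S assume S: "S \<subseteq> {..<m}"
    have finS: "finite S" using S finite_subset by blast
    have "fun_space.dim (fun_space.span (?zero \<union> \<Union> ((\<lambda>i. e.extension (?A i)) ` S))) =
        fun_space.dim (e.extension (annihilator_forms scale B (\<Inter>i\<in>S. V i)))"
      using annihilator_forms_INT[OF finS, of V] V S
      by (simp only: e.extension_UN[symmetric] e.extension_span lessThan_iff subset_iff)
    also have "\<dots> = mpoly.dim (annihilator_forms scale B (\<Inter>i\<in>S. V i))"
      by (rule e.dim_extension(2)[OF subspace_annihilator_forms fin_dim_annihilator_forms
            order_trans[OF annihilator_forms_subset mpoly_linear_forms_subset]])
    also have "\<dots> = codim scale (\<Inter>i\<in>S. V i)"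
      using V S by (intro dim_annihilator_forms subspace_Inter) auto
    also have "\<dots> = min n (\<Sum>i\<in>S. codim scale (V i))"
      using tr S n unfolding transversal_def by blast
    finally show "fun_space.dim (fun_space.span (?zero \<union> \<Union> ((\<lambda>i. e.extension (?A i)) ` S))) =
        min (fun_space.dim (?L))
          (fun_space.dim ?zero + (\<Sum>i\<in>S. codim scale (V i)))"
      by (simp only: dimL e.tgt.dim_zero add_0_left)
  qed
  from e.tgt.dim_intersection[OF this d(1)] d(2) show ?thesis
    unfolding dimL hom by blast
qed

section \<open>Recovering the codimensions\<close>

text \<open>Multiplication by \<open>p\<close> is injective modulo \<open>u\<^sup>n\<close> because the constant term of \<open>p\<close> is not a zero divisor.\<close>

lemma coeff_mult_eq_0_imp:
  fixes p q :: "int poly"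
  assumes "coeff p 0 \<noteq> 0" "\<And>j. j < n \<Longrightarrow> coeff (p * q) j = 0" "j < n"
  shows "coeff q j = 0"
  using assms(3)
proof (induction j rule: less_induct)
  case (less j)
  have "coeff (p * q) j = (\<Sum>i\<le>j. coeff p i * coeff q (j - i))" by (rule coeff_mult)
  also have "\<dots> = (\<Sum>i\<in>{0}. coeff p i * coeff q (j - i))"
    using less by (intro sum.mono_neutral_right) auto
  finally show ?case using assms(1) assms(2)[OF less.prems] by simp
qed

definition codim_product :: "nat multiset \<Rightarrow> int poly" where
  "codim_product C = (\<Prod>c\<in>#C. 1 - monom 1 c)"

lemma coeff_codim_product:
  assumes "0 < k" "\<forall>c\<in>#C. k \<le> c"
  shows "coeff (codim_product C) k = - int (count C k) \<and> coeff (codim_product C) 0 = 1"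
  using assms(2)
proof (induction C)
  case empty
  then show ?case using assms(1) by (simp add: codim_product_def)
next
  case (add c C)
  have "codim_product (add_mset c C) = codim_product C - monom 1 c * codim_product C"
    by (simp add: codim_product_def left_diff_distrib)
  then show ?case using add assms(1) by (auto simp: coeff_monom_mult)
qed

lemma coeff_0_codim_product: "coeff (codim_product C) 0 = (if 0 \<in># C then 0 else 1)"
  by (induction C) (auto simp: codim_product_def coeff_mult_0)

text \<open>
  After cancelling the common part of the multisets, the smallest element \<open>k\<close> that is left occurs in only
  one of them. If \<open>k < n\<close>, then the coefficient at \<open>k\<close> tells the two products apart. Otherwise all elements
  left are equal to \<open>n\<close>, and the sizes agree.
\<close>

lemma codim_product_inject:
  assumes "size C = size D" "\<forall>c\<in>#C. 0 < c \<and> c \<le> n" "\<forall>c\<in>#D. 0 < c \<and> c \<le> n"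
    and eq: "\<And>j. j < n \<Longrightarrow> coeff (codim_product C) j = coeff (codim_product D) j"
  shows "C = D"
proof -
  define A where "A = C \<inter># D"
  define C' D' where "C' = C - A" and "D' = D - A"
  have CD: "C = A + C'" "D = A + D'"
    by (auto simp: A_def C'_def D'_def multiset_eq_iff min_def)
  have disj: "count C' k = 0 \<or> count D' k = 0" for k
    by (auto simp: A_def C'_def D'_def)
  have sub: "set_mset C' \<subseteq> set_mset C" "set_mset D' \<subseteq> set_mset D" "set_mset A \<subseteq> set_mset C"
    using CD by auto
  have "codim_product A * (codim_product C' - codim_product D') = codim_product C - codim_product D"
    unfolding CD by (simp add: codim_product_def right_diff_distrib)
  then have "coeff (codim_product A * (codim_product C' - codim_product D')) j = 0" if "j < n" for j
    using eq[OF that] by simp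
  moreover have "coeff (codim_product A) 0 \<noteq> 0"
    using sub(3) assms(2) by (auto simp: coeff_0_codim_product)
  ultimately have eq': "coeff (codim_product C') j = coeff (codim_product D') j" if "j < n" for j
    using coeff_mult_eq_0_imp[of "codim_product A" n "codim_product C' - codim_product D'" j] that by simp
  have size': "size C' = size D'" using assms(1) unfolding CD by simp
  have "C' = {#}"
  proof (rule ccontr)
    assume "C' \<noteq> {#}"
    define k where "k = Min (set_mset (C' + D'))"
    have "k \<in># C' + D'" unfolding k_def using \<open>C' \<noteq> {#}\<close> by (intro Min_in) auto
    have k: "\<forall>c\<in>#C'. k \<le> c" "\<forall>c\<in>#D'. k \<le> c" by (auto simp: k_def)
    have pos: "0 < k" using \<open>k \<in># C' + D'\<close> sub assms(2,3) by auto
    have "count C' k = count D' k"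
    proof (cases "k < n")
      case True
      then show ?thesis
        using eq'[OF True] coeff_codim_product[OF pos k(1)] coeff_codim_product[OF pos k(2)] by simp
    next
      case False
      have "\<forall>c\<in>#C'. c = k" "\<forall>c\<in>#D'. c = k"
        using False k sub assms(2,3) by fastforce+
      then have "C' = replicate_mset (size C') k" "D' = replicate_mset (size D') k"
        by (simp_all add: set_mset_subset_singletonD subset_iff)
      then show ?thesis using size' by (metis)
    qed
    then have "count C' k = 0" "count D' k = 0" using disj[of k] by auto
    then show False using \<open>k \<in># C' + D'\<close> by (simp add: count_eq_zero_iff)
  qed
  then show ?thesis using size' CD by simp
qed

text \<open>The polynomial whose value at \<open>d\<close> is \<open>d + r\<close> choose \<open>r\<close>.\<close>

primrec binomial_poly :: "nat \<Rightarrow> rat poly" where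
  "binomial_poly 0 = 1"
| "binomial_poly (Suc r) = smult (1 / of_nat (Suc r)) ([:of_nat (Suc r), 1:] * binomial_poly r)"

lemma poly_binomial_poly: "poly (binomial_poly r) (of_nat d) = of_nat ((d + r) choose r)"
proof (induction r)
  case (Suc r)
  have "Suc r * (d + Suc r choose Suc r) = Suc (d + r) * (d + r choose r)"
    using Suc_times_binomial[of r "d + r"] by simp
  then have "of_nat (Suc r) * (of_nat (d + Suc r choose Suc r) :: rat) =
      of_nat (Suc (d + r)) * of_nat (d + r choose r)"
    by (simp only: of_nat_mult[symmetric])
  then have "(of_nat (d + Suc r choose Suc r) :: rat) =
      of_nat (Suc (d + r)) * of_nat (d + r choose r) / of_nat (Suc r)"
    by (simp add: field_simps del: of_nat_Suc)
  then show ?case using Suc by (simp add: add_divide_distrib algebra_simps)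
qed simp

lemma binomial_poly_nonzero: "binomial_poly r \<noteq> 0"
  by (induction r) (auto simp del: of_nat_Suc mult_pCons_left)

lemma degree_binomial_poly: "degree (binomial_poly r) = r"
  by (induction r) (auto simp: degree_mult_eq binomial_poly_nonzero simp del: of_nat_Suc mult_pCons_left)

lemma degree_sum_binomial_poly:
  "0 < n \<Longrightarrow> degree (\<Sum>r<n. smult (b r) (binomial_poly r)) < n"
  by (intro degree_sum_less) (auto intro: le_less_trans[OF degree_smult_le] simp: degree_binomial_poly)

lemma binomial_poly_independent:
  "(\<Sum>r<n. smult (b r) (binomial_poly r)) = 0 \<Longrightarrow> r < n \<Longrightarrow> b r = 0"
proof (induction n)
  case (Suc n)
  have "coeff (\<Sum>r<n. smult (b r) (binomial_poly r)) n = 0"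
    using degree_sum_binomial_poly[of n b] by (cases "n = 0") (auto intro: coeff_eq_0)
  then have "b n * coeff (binomial_poly n) n = 0"
    using arg_cong[OF Suc.prems(1), of "\<lambda>p. coeff p n"] by simp
  moreover have "coeff (binomial_poly n) n \<noteq> 0"
    using binomial_poly_nonzero[of n] degree_binomial_poly[of n] by (metis leading_coeff_0_iff)
  ultimately have "b n = 0" by simp
  then show ?case using Suc less_Suc_eq by auto
qed simp

text \<open>
  The Hilbert function of a polynomial ring in \<open>r + 1\<close> variables is \<open>binomial_poly r\<close>, which goes with the
  coefficient of \<open>u\<close> to the power \<open>n - (r + 1)\<close>.
\<close>

definition hilbert_poly :: "nat \<Rightarrow> int poly \<Rightarrow> rat poly" where
  "hilbert_poly n p = (\<Sum>r<n. smult (of_int (coeff p (n - Suc r))) (binomial_poly r))"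

lemma poly_hilbert_poly: "poly (hilbert_poly n p) (of_nat d) = of_int (hilbert_functional n d p)"
proof -
  have "hilbert_functional n d p = (\<Sum>r<n. coeff p (n - Suc r) * polynomial_ring_dim (n - (n - Suc r)) d)"
    unfolding hilbert_functional_def by (rule sum.nat_diff_reindex[symmetric])
  also have "\<dots> = (\<Sum>r<n. coeff p (n - Suc r) * int ((d + r) choose r))"
    by (intro sum.cong refl) (simp add: polynomial_ring_dim_def)
  finally show ?thesis by (simp add: hilbert_poly_def poly_sum poly_binomial_poly)
qed

text \<open>
  The functional is linear and its values are those of a polynomial of degree less than \<open>n\<close>, which is
  determined by \<open>n\<close> values; the coefficients are recovered because the polynomials \<open>binomial_poly r\<close> have
  distinct degrees.
\<close>

lemma hilbert_functional_determines_coeffs: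
  assumes eq: "\<And>d. d \<in> {m..<m + n} \<Longrightarrow> hilbert_functional n d p = hilbert_functional n d q"
    and j: "j < n"
  shows "coeff p j = coeff q j"
proof -
  let ?h = "hilbert_poly n (p - q)"
  have roots: "of_nat ` {m..<m + n} \<subseteq> {x. poly ?h x = 0}"
    using eq by (auto simp: poly_hilbert_poly hilbert_functional_diff)
  have "?h = 0"
  proof (rule ccontr)
    assume "?h \<noteq> 0"
    then have "finite {x. poly ?h x = 0}" "card {x. poly ?h x = 0} \<le> degree ?h"
      using poly_roots_finite card_poly_roots_bound by blast+
    then have "card (of_nat ` {m..<m + n} :: rat set) \<le> degree ?h"
      using card_mono[OF _ roots] by linarith
    moreover have "card (of_nat ` {m..<m + n} :: rat set) = n"
      by (subst card_image) (auto simp: inj_on_def)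
    moreover have "degree ?h < n" unfolding hilbert_poly_def using j by (intro degree_sum_binomial_poly) simp
    ultimately show False by simp
  qed
  then have "(of_int (coeff (p - q) (n - Suc (n - Suc j))) :: rat) = 0"
    unfolding hilbert_poly_def using j by (intro binomial_poly_independent[of _ n]) auto
  moreover have "n - Suc (n - Suc j) = j" using j by simp
  ultimately show ?thesis by simp
qed

theorem proposition7p1:
  fixes scale :: "'k::field \<Rightarrow> 'v::ab_group_add \<Rightarrow> 'v"
    and scale' :: "'l::field \<Rightarrow> 'w::ab_group_add \<Rightarrow> 'w"
    and B :: "'v set" and B' :: "'w set"
    and V :: "nat \<Rightarrow> 'v set" and V' :: "nat \<Rightarrow> 'w set"
    and n m :: nat
  assumes "finite_dimensional_vector_space scale B"
    and "finite_dimensional_vector_space scale' B'"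
    and "vector_space.dim scale UNIV = n"
    and "vector_space.dim scale' UNIV = n"
    and "\<forall>j<m. module.subspace scale (V j)"
    and "\<forall>j<m. module.subspace scale' (V' j)"
    and "transversal scale m V"
    and "transversal scale' m V'"
  shows "(\<exists>q. is_hilbert_polynomial (arrangement_ideal scale B m V) q \<and>
           (\<forall>d\<in>{m..<m + n}.
              of_nat (hilbert_function (arrangement_ideal scale B m V) d) = poly q (of_nat d)))
       \<and> ((n > 0 \<longrightarrow> (\<forall>j<m. V j \<noteq> UNIV)) \<longrightarrow>
           (\<forall>d\<in>{m..<m + n}. hilbert_function (arrangement_ideal scale B m V) d =
                            hilbert_function (arrangement_ideal scale' B' m V') d) \<longrightarrow>
           image_mset (\<lambda>j. codim scale (V j)) (mset_set {..<m}) =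
           image_mset (\<lambda>j. codim scale' (V' j)) (mset_set {..<m}))"
proof (intro conjI impI)
  let ?C = "image_mset (\<lambda>j. codim scale (V j)) (mset_set {..<m})"
  let ?C' = "image_mset (\<lambda>j. codim scale' (V' j)) (mset_set {..<m})"
  have prods: "(\<Prod>i<m. 1 - monom 1 (codim scale (V i))) = codim_product ?C"
      "(\<Prod>i<m. 1 - monom 1 (codim scale' (V' i))) = codim_product ?C'"
    by (simp_all add: codim_product_def prod_unfold_prod_mset image_mset.compositionality comp_def)
  note hilb = hilbert_function_arrangement_ideal[OF assms(1,3,5,7), unfolded prods]
    and hilb' = hilbert_function_arrangement_ideal[OF assms(2,4,6,8), unfolded prods]
  show "\<exists>q. is_hilbert_polynomial (arrangement_ideal scale B m V) q \<and>
           (\<forall>d\<in>{m..<m + n}.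
              of_nat (hilbert_function (arrangement_ideal scale B m V) d) = poly q (of_nat d))"
  proof (intro exI conjI)
    let ?q = "hilbert_poly n (codim_product ?C)"
    have val: "of_nat (hilbert_function (arrangement_ideal scale B m V) d) = poly ?q (of_nat d)"
      if "m \<le> d" "0 < d \<or> 0 < n" for d
      unfolding poly_hilbert_poly hilb[OF that, symmetric] by simp
    then show "\<forall>d\<in>{m..<m + n}.
        of_nat (hilbert_function (arrangement_ideal scale B m V) d) = poly ?q (of_nat d)"
      by auto
    show "is_hilbert_polynomial (arrangement_ideal scale B m V) ?q"
      unfolding is_hilbert_polynomial_def using eventually_ge_at_top[of "Suc m"]
      by eventually_elim (rule val, auto)
  qed
  assume V: "0 < n \<longrightarrow> (\<forall>j<m. V j \<noteq> UNIV)"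
    and same: "\<forall>d\<in>{m..<m + n}. hilbert_function (arrangement_ideal scale B m V) d =
                            hilbert_function (arrangement_ideal scale' B' m V') d"
  show "?C = ?C'"
  proof (cases "n = 0")
    case True
    then show ?thesis using assms(3,4) by (simp add: codim_def)
  next
    case False
    have nz: "codim scale (V j) \<noteq> 0" if "j < m" for j
    proof
      interpret finite_dimensional_vector_space scale B by fact
      assume "codim scale (V j) = 0"
      then have "dim UNIV \<le> dim (V j)" by (simp add: codim_def)
      then have "V j = UNIV" using subspace_dim_equal[of "V j" UNIV] assms(5) that by simp
      then show False using V False that by simp
    qed
    have pos: "0 \<notin># ?C"
    proof
      assume "0 \<in># ?C"
      then obtain j where "j < m" "codim scale (V j) = 0" by auto
      then show False using nz by blast
    qed
    have coeffs: "coeff (codim_product ?C) j = coeff (codim_product ?C') j" if "j < n" for j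
    proof (rule hilbert_functional_determines_coeffs[OF _ that])
      fix d assume d: "d \<in> {m..<m + n}"
      then show "hilbert_functional n d (codim_product ?C) = hilbert_functional n d (codim_product ?C')"
        using hilb[of d] hilb'[of d] same False by auto
    qed
    have pos': "0 \<notin># ?C'"
      using coeffs[of 0] pos False by (simp add: coeff_0_codim_product split: if_splits)
    have le: "\<forall>c\<in>#?C. c \<le> n" "\<forall>c\<in>#?C'. c \<le> n"
      using assms(3,4) by (auto simp: codim_def)
    show ?thesis
    proof (rule codim_product_inject[OF _ _ _ coeffs])
      show "\<forall>c\<in>#?C. 0 < c \<and> c \<le> n" using le(1) pos by (metis gr0I)
      show "\<forall>c\<in>#?C'. 0 < c \<and> c \<le> n" using le(2) pos' by (metis gr0I)
    qed simp_all
  qed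
qed

end
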